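(* The noncommutative linear plethystic bialgebra with noncommuting variables $\mathcal P^{\diamondsuit,\mathrm{nc}}_{\mathrm{lin}}$ is isomorphic to the homotopy cardinality of the incidence bialgebra of the simplicial groupoid $\mathcal B\,\mathcal T_{\mathsf M^{\mathrm r}}(\mathsf{Ass})$ (bar construction relative to $\mathsf M^{\mathrm r}$).
   Context: Monads and operads. $\mathsf{M}^{\mathrm r}$ is the monad on the category of groupoids sending $A$ to $\bigsqcup_{n\ge 1}A^n$ (nonempty tuples, morphisms componentwise), unit $a\mapsto (a)$, multiplication $\mu$ concatenation. An $\mathsf M^{\mathrm r}$-operad $Q$ consists of groupoids $Q_0$ (colours), $Q_1$ (operations), functors $s\colon Q_1\to\mathsf M^{\mathrm r}Q_0$, $t\colon Q_1\to Q_0$, composition $m\colon\mathsf M^{\mathrm r}Q_1\times_{\mathsf M^{\mathrm r}Q_0}Q_1\to Q_1$ (the $Q_1$ factor the root) and units $e$, with the usual laws. $\mathsf{Ass}$ is the terminal $\mathsf M^{\mathrm r}$-operad on one colour ($Q_0=1$, $Q_1=\mathsf M^{\mathrm r}1$ discrete, composition $\mu$). $\mathcal T$-construction. (i) For a category $C$ internal to groupoids with discrete $C_0$, $\mathcal T_{\mathsf M^{\mathrm r}}(C)$ is the $\mathsf M^{\mathrm r}$-operad with colours $C_0$ whose operations are the pullback of $\mathsf M^{\mathrm r}(\text{target})$ along $C_0\times\mathsf M^{\mathrm r}1\to\mathsf M^{\mathrm r}C_0$, $(c,(\ast,\dots,\ast))\mapsto(c,\dots,c)$: nonempty tuples $(f_1,\dots,f_n)$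 of arrows with common target $c$ (inputs the sources, output $c$); composition $(f_1,\dots,f_k)\circ((g^1_j)_j,\dots,(g^k_j)_j)=(f_1g^1_1,\dots,f_1g^1_{n_1},\dots,f_kg^k_{n_k})$; units identities. (ii) For an $\mathsf M^{\mathrm r}$-operad $Q$ with discrete $Q_0$, $\mathcal T^{\mathsf M^{\mathrm r}}(Q)$ is the category with objects $Q_0$, arrows $c\to d$ the operations with all inputs $c$ and output $d$, composition $y\circ x=m((x,\dots,x);y)$, identities $e$ (for $\mathsf{Ass}$: the monoid $(\mathbb N_{\ge1},\times)$). (iii) $\mathcal T_{\mathsf M^{\mathrm r}}(Q):=\mathcal T_{\mathsf M^{\mathrm r}}(\mathcal T^{\mathsf M^{\mathrm r}}(Q))$. Bar construction. For an $\mathsf M^{\mathrm r}$-operad $Q$, $Q_n:=\mathsf M^{\mathrm r}Q_{n-1}\times_{\mathsf M^{\mathrm r}Q_0}Q_1$ ($n\ge2$). $\mathcal BQ$ has $n$-simplices $\mathsf M^{\mathrm r}Q_n$; $d_0$ discards the top (leafward) level keeping outputs, $d_n$ discards the root level and flattens via $\mu$, inner faces compose adjacent levels via $m$, degeneracies insert units. Incidence bialgebra. $|G|=\sum_{[x]}1/|\mathrm{Aut}(x)|$. For $X=\mathcal BQ$, $\mathbb Q_{\pi_0X_1}$ has basis $\delta_a$; $\Delta(\delta_f)=\sum_{a,b}\frac{|\Phi_{f;a,b}|}{|\mathrm{Aut}(a)||\mathrm{Aut}(b)|}\delta_a\otimes\delta_b$ with $\Phi_{f;a,b}$ the homotopy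 fibre over $(a,b)$ of $(d_2,d_0)$ restricted to the homotopy fibre of $d_1$ over $f$; $\epsilon(\delta_f)=$ cardinality of the homotopy fibre of $s_0$ over $f$; product by concatenation of sequences (unit adjoined). The bialgebra. $W$ is the set of nonempty finite words $\omega=\omega_1\cdots\omega_n$ in positive integers, $\mathbf x_\omega=x_{\omega_1}\cdots x_{\omega_n}$. Let $R$ be a noncommutative unital ring; power series in noncommuting variables $x_1,x_2,\dots$ without constant term with coefficients in $R$ are written $F=\sum_{\omega\in W}f_\omega\mathbf x_\omega$, with plethystic substitution $(G\circledast F)(x_1,x_2,\dots)=G(F_1,F_2,\dots)$, $F_k(x_1,x_2,\dots)=F(x_k,x_{2k},\dots)$. $\mathcal P^{\diamondsuit,\mathrm{nc}}_{\mathrm{lin}}$ is the free associative unital algebra $\mathbb Q\langle a_\omega:\omega\in W\rangle$ on the maps $a_\omega(F)=f_\omega$, with comultiplication induced by plethystic substitution ($\Delta(a_\omega)(F,G)=a_\omega(G\circledast F)$) and counit $\epsilon(a_\omega)=a_\omega(x_1)$. *)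

theory Defs
  imports Complex_Main "HOL-Library.Poly_Mapping" "HOL-Library.Product_Plus"
begin

section \<open>Groupoids\<close>

text \<open>A small groupoid; \<open>Cmp G g f\<close> is the composite of \<open>f\<close> followed by \<open>g\<close>.\<close>

record ('o, 'a) gpd =
  Obj :: "'o set"
  Arr :: "'a set"
  Dom :: "'a \<Rightarrow> 'o"
  Cod :: "'a \<Rightarrow> 'o"
  Idt :: "'o \<Rightarrow> 'a"
  Cmp :: "'a \<Rightarrow> 'a \<Rightarrow> 'a"

record ('o, 'a, 'p, 'b) fnc =
  fob :: "'o \<Rightarrow> 'p"
  far :: "'a \<Rightarrow> 'b"

definition groupoid :: "('o, 'a) gpd \<Rightarrow> bool" where
  "groupoid G \<longleftrightarrow>
     (\<forall>f\<in>Arr G. Dom G f \<in> Obj G \<and> Cod G f \<in> Obj G) \<and>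
     (\<forall>x\<in>Obj G. Idt G x \<in> Arr G \<and> Dom G (Idt G x) = x \<and> Cod G (Idt G x) = x) \<and>
     (\<forall>f\<in>Arr G. \<forall>g\<in>Arr G. Dom G g = Cod G f \<longrightarrow>
        Cmp G g f \<in> Arr G \<and> Dom G (Cmp G g f) = Dom G f \<and> Cod G (Cmp G g f) = Cod G g) \<and>
     (\<forall>f\<in>Arr G. Cmp G f (Idt G (Dom G f)) = f \<and> Cmp G (Idt G (Cod G f)) f = f) \<and>
     (\<forall>f\<in>Arr G. \<forall>g\<in>Arr G. \<forall>h\<in>Arr G. Dom G g = Cod G f \<longrightarrow> Dom G h = Cod G g \<longrightarrow>
        Cmp G h (Cmp G g f) = Cmp G (Cmp G h g) f) \<and>
     (\<forall>f\<in>Arr G. \<exists>g\<in>Arr G. Dom G g = Cod G f \<and> Cod G g = Dom G f \<and>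
        Cmp G g f = Idt G (Dom G f) \<and> Cmp G f g = Idt G (Cod G f))"

definition gfunctor :: "('o, 'a) gpd \<Rightarrow> ('p, 'b) gpd \<Rightarrow> ('o, 'a, 'p, 'b) fnc \<Rightarrow> bool" where
  "gfunctor A B F \<longleftrightarrow>
     (\<forall>x\<in>Obj A. fob F x \<in> Obj B \<and> far F (Idt A x) = Idt B (fob F x)) \<and>
     (\<forall>f\<in>Arr A. far F f \<in> Arr B \<and> Dom B (far F f) = fob F (Dom A f) \<and>
        Cod B (far F f) = fob F (Cod A f)) \<and>
     (\<forall>f\<in>Arr A. \<forall>g\<in>Arr A. Dom A g = Cod A f \<longrightarrow>
        far F (Cmp A g f) = Cmp B (far F g) (far F f))"

definition fcomp :: "('p, 'b, 'q, 'c) fnc \<Rightarrow> ('o, 'a, 'p, 'b) fnc \<Rightarrow> ('o, 'a, 'q, 'c) fnc" where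
  "fcomp G F = \<lparr>fob = fob G \<circ> fob F, far = far G \<circ> far F\<rparr>"

definition discrete :: "'o set \<Rightarrow> ('o, 'o) gpd" where
  "discrete A = \<lparr>Obj = A, Arr = A, Dom = id, Cod = id, Idt = id, Cmp = (\<lambda>g f. g)\<rparr>"

definition prod_gpd :: "('o, 'a) gpd \<Rightarrow> ('p, 'b) gpd \<Rightarrow> ('o \<times> 'p, 'a \<times> 'b) gpd" where
  "prod_gpd A B = \<lparr>Obj = Obj A \<times> Obj B, Arr = Arr A \<times> Arr B,
     Dom = map_prod (Dom A) (Dom B), Cod = map_prod (Cod A) (Cod B),
     Idt = map_prod (Idt A) (Idt B),
     Cmp = (\<lambda>(g, g') (f, f'). (Cmp A g f, Cmp B g' f'))\<rparr>"

definition sub_gpd :: "('o, 'a) gpd \<Rightarrow> ('o \<Rightarrow> bool) \<Rightarrow> ('a \<Rightarrow> bool) \<Rightarrow> ('o, 'a) gpd" where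
  "sub_gpd G P R = G\<lparr>Obj := {x \<in> Obj G. P x}, Arr := {f \<in> Arr G. R f}\<rparr>"

text \<open>The strict pullback \<open>A \<times>\<^sub>C B\<close>.\<close>

definition pullback ::
  "('o, 'a, 'q, 'c) fnc \<Rightarrow> ('p, 'b, 'q, 'c) fnc \<Rightarrow> ('o, 'a) gpd \<Rightarrow> ('p, 'b) gpd
     \<Rightarrow> ('o \<times> 'p, 'a \<times> 'b) gpd" where
  "pullback F G A B = sub_gpd (prod_gpd A B)
     (\<lambda>(x, y). fob F x = fob G y) (\<lambda>(f, g). far F f = far G g)"

text \<open>Renaming of objects and arrows along injections \<open>p\<close>, \<open>q\<close> with left inverses \<open>p'\<close>, \<open>q'\<close>.\<close>

definition rename ::
  "('o \<Rightarrow> 'p) \<Rightarrow> ('p \<Rightarrow> 'o) \<Rightarrow> ('a \<Rightarrow> 'b) \<Rightarrow> ('b \<Rightarrow> 'a) \<Rightarrow> ('o, 'a) gpd \<Rightarrow> ('p, 'b) gpd" where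
  "rename p p' q q' G = \<lparr>Obj = p ` Obj G, Arr = q ` Arr G,
     Dom = p \<circ> Dom G \<circ> q', Cod = p \<circ> Cod G \<circ> q', Idt = q \<circ> Idt G \<circ> p',
     Cmp = (\<lambda>g f. q (Cmp G (q' g) (q' f)))\<rparr>"

section \<open>Homotopy cardinality and homotopy fibres\<close>

definition iso_rel :: "('o, 'a) gpd \<Rightarrow> ('o \<times> 'o) set" where
  "iso_rel G = {(x, y). x \<in> Obj G \<and> y \<in> Obj G \<and> (\<exists>f\<in>Arr G. Dom G f = x \<and> Cod G f = y)}"

definition pi0 :: "('o, 'a) gpd \<Rightarrow> 'o set set" where
  "pi0 G = Obj G // iso_rel G"

definition iso_class :: "('o, 'a) gpd \<Rightarrow> 'o \<Rightarrow> 'o set" where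
  "iso_class G x = iso_rel G `` {x}"

definition rep :: "'o set \<Rightarrow> 'o" where
  "rep c = (SOME x. x \<in> c)"

definition Aut :: "('o, 'a) gpd \<Rightarrow> 'o \<Rightarrow> 'a set" where
  "Aut G x = {f \<in> Arr G. Dom G f = x \<and> Cod G f = x}"

definition finite_gpd :: "('o, 'a) gpd \<Rightarrow> bool" where
  "finite_gpd G \<longleftrightarrow> finite (pi0 G) \<and> (\<forall>x\<in>Obj G. finite (Aut G x))"

text \<open>Only meaningful for groupoids satisfying \<^const>\<open>finite_gpd\<close>.\<close>

definition hcard :: "('o, 'a) gpd \<Rightarrow> rat" where
  "hcard G = (\<Sum>c\<in>pi0 G. 1 / of_nat (card (Aut G (rep c))))"

text \<open>
  Homotopy fibre of \<open>F : A \<rightarrow> B\<close> over \<open>b\<close>: objects are pairs \<open>(a, \<beta>)\<close> with \<open>\<beta> : F a \<rightarrow> b\<close>, and an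
  arrow \<open>(a, \<beta>) \<rightarrow> (a', \<beta>')\<close> is an \<open>\<alpha> : a \<rightarrow> a'\<close> with \<open>\<beta>' \<circ> F \<alpha> = \<beta>\<close>, stored with its endpoints.
\<close>

definition hfib ::
  "('o, 'a, 'p, 'b) fnc \<Rightarrow> ('o, 'a) gpd \<Rightarrow> ('p, 'b) gpd \<Rightarrow> 'p
     \<Rightarrow> ('o \<times> 'b, ('o \<times> 'b) \<times> 'a \<times> ('o \<times> 'b)) gpd" where
  "hfib F A B b =
     (let Ob = {(a, \<beta>). a \<in> Obj A \<and> \<beta> \<in> Arr B \<and> Dom B \<beta> = fob F a \<and> Cod B \<beta> = b} in
      \<lparr>Obj = Ob,
       Arr = {(x, \<alpha>, y). x \<in> Ob \<and> y \<in> Ob \<and> \<alpha> \<in> Arr A \<and> Dom A \<alpha> = fst x \<and> Cod A \<alpha> = fst y \<and>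
                Cmp B (snd y) (far F \<alpha>) = snd x},
       Dom = (\<lambda>(x, \<alpha>, y). x),
       Cod = (\<lambda>(x, \<alpha>, y). y),
       Idt = (\<lambda>x. (x, Idt A (fst x), x)),
       Cmp = (\<lambda>(_, \<alpha>', z) (x, \<alpha>, _). (x, Cmp A \<alpha>' \<alpha>, z))\<rparr>)"

text \<open>The projection of a homotopy fibre to the domain.\<close>

definition hfib_proj :: "('o \<times> 'b, ('o \<times> 'b) \<times> 'a \<times> ('o \<times> 'b), 'o, 'a) fnc" where
  "hfib_proj = \<lparr>fob = fst, far = fst \<circ> snd\<rparr>"

section \<open>The monad of nonempty tuples and its operads\<close>

definition Mr :: "('o, 'a) gpd \<Rightarrow> ('o list, 'a list) gpd" where
  "Mr G = \<lparr>Obj = {xs. xs \<noteq> [] \<and> set xs \<subseteq> Obj G}, Arr = {fs. fs \<noteq> [] \<and> set fs \<subseteq> Arr G},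
     Dom = map (Dom G), Cod = map (Cod G), Idt = map (Idt G), Cmp = map2 (Cmp G)\<rparr>"

definition Mr_map :: "('o, 'a, 'p, 'b) fnc \<Rightarrow> ('o list, 'a list, 'p list, 'b list) fnc" where
  "Mr_map F = \<lparr>fob = map (fob F), far = map (far F)\<rparr>"

definition Mr_mu :: "('o list list, 'a list list, 'o list, 'a list) fnc" where
  "Mr_mu = \<lparr>fob = concat, far = concat\<rparr>"

text \<open>
  In \<open>com\<close>, the second component of the argument is the root.  The laws are imposed by \<open>Mr_operad\<close>.
\<close>

record ('c, 'ca, 'o, 'oa) operad =
  col :: "('c, 'ca) gpd"
  opr :: "('o, 'oa) gpd"
  src :: "('o, 'oa, 'c list, 'ca list) fnc"
  tgt :: "('o, 'oa, 'c, 'ca) fnc"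
  com :: "('o list \<times> 'o, 'oa list \<times> 'oa, 'o, 'oa) fnc"
  unt :: "('c, 'ca, 'o, 'oa) fnc"

text \<open>The operad laws, stated once for elements and then used for both objects and arrows.\<close>

definition operad_laws ::
  "'c set \<Rightarrow> 'o set \<Rightarrow> ('o \<Rightarrow> 'c list) \<Rightarrow> ('o \<Rightarrow> 'c) \<Rightarrow> ('o list \<times> 'o \<Rightarrow> 'o) \<Rightarrow> ('c \<Rightarrow> 'o) \<Rightarrow> bool" where
  "operad_laws C D s t m e \<longleftrightarrow>
     (\<forall>c\<in>C. s (e c) = [c] \<and> t (e c) = c) \<and>
     (\<forall>xs y. set xs \<subseteq> D \<longrightarrow> y \<in> D \<longrightarrow> map t xs = s y \<longrightarrow>
        s (m (xs, y)) = concat (map s xs) \<and> t (m (xs, y)) = t y) \<and>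
     (\<forall>y\<in>D. m (map e (s y), y) = y \<and> m ([y], e (t y)) = y) \<and>
     (\<forall>xss ys z. (\<forall>xs\<in>set xss. set xs \<subseteq> D) \<longrightarrow> set ys \<subseteq> D \<longrightarrow> z \<in> D \<longrightarrow>
        list_all2 (\<lambda>xs y. map t xs = s y) xss ys \<longrightarrow> map t ys = s z \<longrightarrow>
        m (map2 (\<lambda>xs y. m (xs, y)) xss ys, z) = m (concat xss, m (ys, z)))"

definition Mr_operad :: "('c, 'ca, 'o, 'oa) operad \<Rightarrow> bool" where
  "Mr_operad Q \<longleftrightarrow>
     groupoid (col Q) \<and> groupoid (opr Q) \<and>
     gfunctor (opr Q) (Mr (col Q)) (src Q) \<and> gfunctor (opr Q) (col Q) (tgt Q) \<and>
     gfunctor (pullback (Mr_map (tgt Q)) (src Q) (Mr (opr Q)) (opr Q)) (opr Q) (com Q) \<and>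
     gfunctor (col Q) (opr Q) (unt Q) \<and>
     operad_laws (Obj (col Q)) (Obj (opr Q))
       (fob (src Q)) (fob (tgt Q)) (fob (com Q)) (fob (unt Q)) \<and>
     operad_laws (Arr (col Q)) (Arr (opr Q))
       (far (src Q)) (far (tgt Q)) (far (com Q)) (far (unt Q))"

text \<open>The unique operation of arity \<open>n \<ge> 1\<close> is the list of length \<open>n\<close> over the unit type.\<close>

definition Ass :: "(unit, unit, unit list, unit list) operad" where
  "Ass = \<lparr>col = discrete {()}, opr = Mr (discrete {()}),
     src = \<lparr>fob = id, far = id\<rparr>,
     tgt = \<lparr>fob = (\<lambda>_. ()), far = (\<lambda>_. ())\<rparr>,
     com = fcomp Mr_mu \<lparr>fob = fst, far = fst\<rparr>,
     unt = \<lparr>fob = (\<lambda>c. [c]), far = (\<lambda>c. [c])\<rparr>\<rparr>"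

section \<open>The T-construction\<close>

text \<open>
  A category internal to groupoids; \<open>ccom\<close> sends a composable pair \<open>(g, f)\<close> (source of \<open>g\<close> equal to
  target of \<open>f\<close>) to the composite of \<open>f\<close> followed by \<open>g\<close>.
\<close>

record ('c, 'ca, 'f, 'fa) icat =
  cob :: "('c, 'ca) gpd"
  car :: "('f, 'fa) gpd"
  csrc :: "('f, 'fa, 'c, 'ca) fnc"
  ctgt :: "('f, 'fa, 'c, 'ca) fnc"
  ccom :: "('f \<times> 'f, 'fa \<times> 'fa, 'f, 'fa) fnc"
  cid :: "('c, 'ca, 'f, 'fa) fnc"

text \<open>
  From categories to operads.  A tuple of arrows with common target is nonempty, hence determines
  that target, so the pullback of \<open>Mr (target)\<close> along \<open>C\<^sub>0 \<times> Mr 1 \<rightarrow> Mr C\<^sub>0\<close> is rendered as a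
  subgroupoid of \<open>Mr C\<^sub>1\<close>, with output the target of the first entry.
\<close>

definition T_op :: "('c, 'ca, 'f, 'fa) icat \<Rightarrow> ('c, 'ca, 'f list, 'fa list) operad" where
  "T_op C = \<lparr>col = cob C,
     opr = sub_gpd (Mr (car C))
       (\<lambda>fs. \<exists>c\<in>Obj (cob C). map (fob (ctgt C)) fs = replicate (length fs) c)
       (\<lambda>\<phi>s. \<exists>\<gamma>\<in>Arr (cob C). map (far (ctgt C)) \<phi>s = replicate (length \<phi>s) \<gamma>),
     src = Mr_map (csrc C),
     tgt = \<lparr>fob = fob (ctgt C) \<circ> hd, far = far (ctgt C) \<circ> hd\<rparr>,
     com = \<lparr>fob = (\<lambda>(gss, fs). concat (map2 (\<lambda>gs f. map (\<lambda>g. fob (ccom C) (f, g)) gs) gss fs)),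
            far = (\<lambda>(gss, fs). concat (map2 (\<lambda>gs f. map (\<lambda>g. far (ccom C) (f, g)) gs) gss fs))\<rparr>,
     unt = \<lparr>fob = (\<lambda>c. [fob (cid C) c]), far = (\<lambda>c. [far (cid C) c])\<rparr>\<rparr>"

text \<open>From operads to categories: the operations all of whose inputs coincide.\<close>

definition T_cat :: "('c, 'ca, 'o, 'oa) operad \<Rightarrow> ('c, 'ca, 'o, 'oa) icat" where
  "T_cat Q = \<lparr>cob = col Q,
     car = sub_gpd (opr Q)
       (\<lambda>x. \<exists>c\<in>Obj (col Q). fob (src Q) x = replicate (length (fob (src Q) x)) c)
       (\<lambda>\<xi>. \<exists>\<gamma>\<in>Arr (col Q). far (src Q) \<xi> = replicate (length (far (src Q) \<xi>)) \<gamma>),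
     csrc = \<lparr>fob = hd \<circ> fob (src Q), far = hd \<circ> far (src Q)\<rparr>,
     ctgt = tgt Q,
     ccom = \<lparr>fob = (\<lambda>(y, x). fob (com Q) (replicate (length (fob (src Q) y)) x, y)),
             far = (\<lambda>(y, x). far (com Q) (replicate (length (far (src Q) y)) x, y))\<rparr>,
     cid = unt Q\<rparr>"

definition T_Mr :: "('c, 'ca, 'o, 'oa) operad \<Rightarrow> ('c, 'ca, 'o list, 'oa list) operad" where
  "T_Mr Q = T_op (T_cat Q)"

subsection \<open>The operad laws for Ass and its T-construction\<close>

text \<open>Groupoids isomorphic to discrete ones; \<^const>\<open>Ass\<close> and \<open>T_Mr Ass\<close> consist of such groupoids.\<close>

definition disc :: "('o, 'o) gpd \<Rightarrow> bool" where
  "disc G \<longleftrightarrow> Arr G = Obj G \<and>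
     (\<forall>x\<in>Obj G. Dom G x = x \<and> Cod G x = x \<and> Idt G x = x \<and> Cmp G x x = x)"

lemma disc_discrete: "disc (discrete A)"
  by (simp add: disc_def discrete_def)

lemma disc_Mr: "disc G \<Longrightarrow> disc (Mr G)"
  by (auto simp: disc_def Mr_def zip_same_conv_map subset_iff intro!: map_idI)

lemma disc_sub_gpd: "disc G \<Longrightarrow> P = R \<Longrightarrow> disc (sub_gpd G P R)"
  by (auto simp: disc_def sub_gpd_def)

lemma disc_prod_gpd: "disc A \<Longrightarrow> disc B \<Longrightarrow> disc (prod_gpd A B)"
  by (auto simp: disc_def prod_gpd_def)

lemma disc_pullback:
  "disc A \<Longrightarrow> disc B \<Longrightarrow> fob F = far F \<Longrightarrow> fob G = far G \<Longrightarrow> disc (pullback F G A B)"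
  unfolding pullback_def by (rule disc_sub_gpd) (simp_all add: disc_prod_gpd)

lemma groupoid_disc: "disc G \<Longrightarrow> groupoid G"
  by (force simp: disc_def groupoid_def)

lemma gfunctor_disc:
  "disc A \<Longrightarrow> disc B \<Longrightarrow> fob F = far F \<Longrightarrow> fob F ` Obj A \<subseteq> Obj B \<Longrightarrow> gfunctor A B F"
  by (auto simp: disc_def gfunctor_def image_subset_iff)

lemma Mr_map_far: "far F = fob F \<Longrightarrow> far (Mr_map F) = fob (Mr_map F)"
  by (simp add: Mr_map_def)

lemma Mr_operad_disc:
  assumes "disc (col Q)" "disc (opr Q)"
    and "far (src Q) = fob (src Q)" "far (tgt Q) = fob (tgt Q)" "far (com Q) = fob (com Q)"
      "far (unt Q) = fob (unt Q)"
    and "fob (src Q) ` Obj (opr Q) \<subseteq> Obj (Mr (col Q))" "fob (tgt Q) ` Obj (opr Q) \<subseteq> Obj (col Q)"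
      "fob (com Q) ` Obj (pullback (Mr_map (tgt Q)) (src Q) (Mr (opr Q)) (opr Q)) \<subseteq> Obj (opr Q)"
      "fob (unt Q) ` Obj (col Q) \<subseteq> Obj (opr Q)"
    and "operad_laws (Obj (col Q)) (Obj (opr Q))
       (fob (src Q)) (fob (tgt Q)) (fob (com Q)) (fob (unt Q))"
  shows "Mr_operad Q"
proof -
  have "Arr (col Q) = Obj (col Q)" "Arr (opr Q) = Obj (opr Q)"
    using assms(1,2) by (auto simp: disc_def)
  then show ?thesis
    unfolding Mr_operad_def
    by (intro conjI groupoid_disc gfunctor_disc disc_pullback disc_Mr)
      (use assms in \<open>simp_all add: Mr_map_far\<close>)
qed

lemma lists_unit_eq: "(xs :: unit list) = ys \<longleftrightarrow> length xs = length ys"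
  by (simp add: list_eq_iff_nth_eq)

lemma map_unit_eq_replicate: "map f xs = replicate (length xs) ()"
  by (simp add: lists_unit_eq)

lemma Mr_operad_Ass: "Mr_operad Ass"
proof (rule Mr_operad_disc)
  show "operad_laws (Obj (col Ass)) (Obj (opr Ass))
     (fob (src Ass)) (fob (tgt Ass)) (fob (com Ass)) (fob (unt Ass))"
  proof -
    have "concat (map2 (\<lambda>xs y. concat xs) xss ys) = concat (concat xss)"
      if "length xss = length ys" for xss :: "unit list list list" and ys :: "unit list list"
      using that by (induction xss ys rule: list_induct2) auto
    moreover have "concat (map (\<lambda>c. [()]) y) = y" for y :: "unit list"
      by (simp add: lists_unit_eq)
    ultimately show ?thesis
      by (simp add: operad_laws_def Ass_def fcomp_def Mr_mu_def list_all2_lengthD)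
  qed
  show "disc (col Ass)" "disc (opr Ass)"
    by (simp_all add: Ass_def disc_discrete disc_Mr)
  show "fob (com Ass) ` Obj (pullback (Mr_map (tgt Ass)) (src Ass) (Mr (opr Ass)) (opr Ass))
      \<subseteq> Obj (opr Ass)"
  proof -
    have "concat xs \<noteq> []" if "xs \<noteq> []" "\<forall>x\<in>set xs. x \<noteq> []" for xs :: "unit list list"
      using that by (cases xs) auto
    then show ?thesis
      by (force simp: Ass_def fcomp_def Mr_mu_def Mr_def discrete_def pullback_def sub_gpd_def
          prod_gpd_def simp del: concat_eq_Nil_conv)
  qed
  show "far (src Ass) = fob (src Ass)" "far (tgt Ass) = fob (tgt Ass)" "far (com Ass) = fob (com Ass)"
      "far (unt Ass) = fob (unt Ass)"
    by (simp_all add: Ass_def fcomp_def Mr_mu_def)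
  show "fob (src Ass) ` Obj (opr Ass) \<subseteq> Obj (Mr (col Ass))" by (simp add: Ass_def)
  show "fob (tgt Ass) ` Obj (opr Ass) \<subseteq> Obj (col Ass)" by (auto simp: Ass_def discrete_def)
  show "fob (unt Ass) ` Obj (col Ass) \<subseteq> Obj (opr Ass)" by (simp add: Ass_def discrete_def Mr_def)
qed

text \<open>
  The operations of \<open>T_Mr Ass\<close> are the nonempty tuples of positive integers, a positive integer \<open>n\<close>
  being represented by the list of length \<open>n\<close> over the unit type.
\<close>

definition unary_words :: "unit list list set" where
  "unary_words = {fs. fs \<noteq> [] \<and> [] \<notin> set fs}"

lemma T_Mr_Ass_simps:
  "col (T_Mr Ass) = discrete {()}"
  "Obj (opr (T_Mr Ass)) = unary_words" "Arr (opr (T_Mr Ass)) = unary_words"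
  "Dom (opr (T_Mr Ass)) = id" "Cod (opr (T_Mr Ass)) = id" "Idt (opr (T_Mr Ass)) = id"
  "Cmp (opr (T_Mr Ass)) = map2 (map2 (\<lambda>g f. g))"
  "fob (src (T_Mr Ass)) = map (\<lambda>_. ())" "far (src (T_Mr Ass)) = map (\<lambda>_. ())"
  "fob (tgt (T_Mr Ass)) = (\<lambda>_. ())" "far (tgt (T_Mr Ass)) = (\<lambda>_. ())"
  "fob (com (T_Mr Ass)) =
     (\<lambda>(gss, fs). concat (map2 (\<lambda>gs f. map (\<lambda>g. concat (replicate (length f) g)) gs) gss fs))"
  "far (com (T_Mr Ass)) =
     (\<lambda>(gss, fs). concat (map2 (\<lambda>gs f. map (\<lambda>g. concat (replicate (length f) g)) gs) gss fs))"
  "fob (unt (T_Mr Ass)) = (\<lambda>_. [[()]])" "far (unt (T_Mr Ass)) = (\<lambda>_. [[()]])"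
proof -
  have u: "x = replicate (length x) () \<longleftrightarrow> True" for x :: "unit list"
    by (simp add: lists_unit_eq)
  have car: "car (T_cat Ass) = Mr (discrete {()})"
    by (simp add: T_cat_def Ass_def Mr_def discrete_def sub_gpd_def u)
  have opr: "opr (T_Mr Ass) = Mr (Mr (discrete {()}))"
    unfolding T_Mr_def T_op_def car
    by (simp add: T_cat_def Ass_def Mr_def discrete_def sub_gpd_def map_unit_eq_replicate)
  show "Obj (opr (T_Mr Ass)) = unary_words" "Arr (opr (T_Mr Ass)) = unary_words"
    "Dom (opr (T_Mr Ass)) = id" "Cod (opr (T_Mr Ass)) = id" "Idt (opr (T_Mr Ass)) = id"
    "Cmp (opr (T_Mr Ass)) = map2 (map2 (\<lambda>g f. g))"
    unfolding opr by (auto simp: Mr_def discrete_def unary_words_def)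
  have hd: "(hd :: unit list \<Rightarrow> unit) = (\<lambda>_. ())"
    by (rule ext) simp
  show "fob (src (T_Mr Ass)) = map (\<lambda>_. ())" "far (src (T_Mr Ass)) = map (\<lambda>_. ())"
    "fob (tgt (T_Mr Ass)) = (\<lambda>_. ())" "far (tgt (T_Mr Ass)) = (\<lambda>_. ())"
    by (simp_all add: T_Mr_def T_op_def T_cat_def Ass_def Mr_map_def comp_def hd)
qed (simp_all add: T_Mr_def T_op_def T_cat_def Ass_def fcomp_def Mr_mu_def)

definition mulw :: "unit list list \<Rightarrow> unit list \<Rightarrow> unit list list" where
  "mulw gs f = map (\<lambda>g. concat (replicate (length f) g)) gs"

definition comw :: "unit list list list \<Rightarrow> unit list list \<Rightarrow> unit list list" where
  "comw gss fs = concat (map2 mulw gss fs)"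

lemma com_T_Mr_Ass: "fob (com (T_Mr Ass)) (gss, fs) = comw gss fs"
  by (simp add: T_Mr_Ass_simps comw_def mulw_def[abs_def])

lemma comw_Cons [simp]: "comw (gs # gss) (f # fs) = mulw gs f @ comw gss fs"
  and comw_Nil [simp]: "comw [] fs = []" "comw gss [] = []"
  by (simp_all add: comw_def)

lemma length_mulw [simp]: "length (mulw gs f) = length gs"
  by (simp add: mulw_def)

lemma mulw_append [simp]: "mulw (gs @ hs) f = mulw gs f @ mulw hs f"
  by (simp add: mulw_def)

lemma comw_append:
  "length gss = length fs \<Longrightarrow> comw (gss @ hss) (fs @ ks) = comw gss fs @ comw hss ks"
  by (simp add: comw_def)

lemma length_concat_replicate: "length (concat (replicate n xs)) = n * length xs"
  by (induction n) auto

lemma mulw_mulw: "mulw (mulw x y) z = mulw x (concat (replicate (length z) y))"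
proof -
  have "concat (replicate (length z) (concat (replicate (length y) g))) =
      concat (replicate (length (concat (replicate (length z) y))) g)" for g :: "unit list"
    unfolding lists_unit_eq length_concat_replicate by (rule mult.assoc[symmetric])
  then show ?thesis
    unfolding mulw_def list.map_comp comp_def by presburger
qed

lemma mulw_comw: "mulw (comw xs y) z = comw xs (mulw y z)"
proof (induction xs y rule: list_induct2')
  case (4 x xs y ys)
  then show ?case by (simp add: mulw_mulw) (simp add: mulw_def)
qed (simp_all add: mulw_def)

lemma comw_assoc:
  assumes "length ys = length z" "list_all2 (\<lambda>xs y. length xs = length y) xss ys"
  shows "comw (map2 comw xss ys) z = comw (concat xss) (comw ys z)"
  using assms
proof (induction ys z arbitrary: xss rule: list_induct2)
  case (Cons y ys z zs)
  then obtain x xss' where "xss = x # xss'" "length x = length y"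
      "list_all2 (\<lambda>xs y. length xs = length y) xss' ys"
    by (auto simp: list_all2_Cons2)
  with Cons.IH[of xss'] show ?case by (simp add: comw_append mulw_comw)
qed simp

lemma map_unit_eq_iff: "map (\<lambda>_. ()) xs = map (\<lambda>_. ()) ys \<longleftrightarrow> length xs = length ys"
  by (simp add: lists_unit_eq)

lemma src_comw: "length xs = length y \<Longrightarrow> map (\<lambda>_. ()) (comw xs y) = concat (map (map (\<lambda>_. ())) xs)"
  by (induction xs y rule: list_induct2) (simp_all add: mulw_def comp_def)

lemma comw_units: "comw (map (\<lambda>_. [[()]]) (map (\<lambda>_. ()) y)) y = y"
proof (induction y)
  case (Cons f y)
  have "mulw [[()]] f = [f]"
    unfolding mulw_def list.map lists_unit_eq[of _ f] length_concat_replicate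
    by (simp add: lists_unit_eq[of _ f] length_concat_replicate)
  with Cons show ?case by simp
qed simp

lemma comw_in_unary_words:
  assumes "xs \<noteq> []" "set xs \<subseteq> unary_words" "y \<in> unary_words" "length xs = length y"
  shows "comw xs y \<in> unary_words"
proof -
  have "[] \<notin> set (mulw g f)" if "g \<in> unary_words" "f \<noteq> []" for g f
    using that by (auto simp: unary_words_def mulw_def)
  note * = this
  have "[] \<notin> set (comw xs y)" if "length xs = length y" "set xs \<subseteq> unary_words" "[] \<notin> set y"
    using that by (induction xs y rule: list_induct2) (auto simp: *)
  then have "[] \<notin> set (comw xs y)"
    using assms by (simp add: unary_words_def)
  moreover have "comw xs y \<noteq> []"
    using assms by (cases xs; cases y) (auto simp: unary_words_def mulw_def)
  ultimately show ?thesis by (simp add: unary_words_def)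
qed

lemma Mr_operad_T_Mr_Ass: "Mr_operad (T_Mr Ass)"
proof (rule Mr_operad_disc)
  have "comw [y] [[()]] = y" for y
    by (simp add: mulw_def)
  then show "operad_laws (Obj (col (T_Mr Ass))) (Obj (opr (T_Mr Ass)))
     (fob (src (T_Mr Ass))) (fob (tgt (T_Mr Ass))) (fob (com (T_Mr Ass))) (fob (unt (T_Mr Ass)))"
    using comw_assoc src_comw comw_units
    unfolding operad_laws_def com_T_Mr_Ass
    by (simp add: T_Mr_Ass_simps(1-11,14,15) map_unit_eq_iff)
  show "disc (col (T_Mr Ass))"
    by (simp add: T_Mr_Ass_simps disc_discrete)
  show "disc (opr (T_Mr Ass))"
    by (auto simp: disc_def T_Mr_Ass_simps zip_same_conv_map intro!: map_idI)
  show "fob (com (T_Mr Ass)) `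
      Obj (pullback (Mr_map (tgt (T_Mr Ass))) (src (T_Mr Ass)) (Mr (opr (T_Mr Ass))) (opr (T_Mr Ass)))
      \<subseteq> Obj (opr (T_Mr Ass))"
    unfolding image_subset_iff
    by (auto simp: com_T_Mr_Ass T_Mr_Ass_simps(1-11) Mr_map_def Mr_def pullback_def sub_gpd_def
        prod_gpd_def map_unit_eq_iff comw_in_unary_words)
  show "far (com (T_Mr Ass)) = fob (com (T_Mr Ass))"
    by (simp add: T_Mr_Ass_simps)
qed (auto simp: T_Mr_Ass_simps(1-11,14,15) disc_discrete Mr_def discrete_def unary_words_def)

section \<open>The bar construction\<close>

text \<open>
  One type containing (the objects, or the arrows, of) all the \<open>Q\<^sub>n\<close>: \<open>Col\<close> embeds \<open>Q\<^sub>0\<close>, \<open>Opr\<close>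
  embeds \<open>Q\<^sub>1\<close>, and \<open>Node xs y\<close> is the element of \<open>Mr Q\<^bsub>n-1\<^esub> \<times>\<^bsub>Mr Q\<^sub>0\<^esub> Q\<^sub>1\<close> with root \<open>y\<close>.
\<close>

datatype ('c, 'o) lev =
    Col (the_col: 'c)
  | Opr (root_op: 'o)
  | Node (subs: "('c, 'o) lev list") (root_op: 'o)

fun outp :: "('o \<Rightarrow> 'c) \<Rightarrow> ('c, 'o) lev \<Rightarrow> 'c" where
  "outp t (Col c) = c"
| "outp t (Opr y) = t y"
| "outp t (Node xs y) = t y"

definition outp_fun :: "('c, 'ca, 'o, 'oa) operad \<Rightarrow> (('c, 'o) lev, ('ca, 'oa) lev, 'c, 'ca) fnc" where
  "outp_fun Q = \<lparr>fob = outp (fob (tgt Q)), far = outp (far (tgt Q))\<rparr>"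

fun Qn :: "('c, 'ca, 'o, 'oa) operad \<Rightarrow> nat \<Rightarrow> (('c, 'o) lev, ('ca, 'oa) lev) gpd" where
  "Qn Q 0 = rename Col the_col Col the_col (col Q)"
| "Qn Q (Suc 0) = rename Opr root_op Opr root_op (opr Q)"
| "Qn Q (Suc (Suc n)) =
     rename (\<lambda>(xs, y). Node xs y) (\<lambda>x. (subs x, root_op x))
            (\<lambda>(xs, y). Node xs y) (\<lambda>x. (subs x, root_op x))
       (pullback (Mr_map (outp_fun Q)) (src Q) (Mr (Qn Q (Suc n))) (opr Q))"

text \<open>
  The list of elements of \<open>Q\<^bsub>n-1\<^esub>\<close> grafted on the root of an element of \<open>Q\<^sub>n\<close> (\<open>n \<ge> 1\<close>); for \<open>n = 1\<close>
  it is the list of input colours.  Conversely, \<open>graft n\<close> builds an element of \<open>Q\<^sub>n\<close> (\<open>n \<ge> 1\<close>).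
\<close>

fun kids :: "('o \<Rightarrow> 'c list) \<Rightarrow> ('c, 'o) lev \<Rightarrow> ('c, 'o) lev list" where
  "kids s (Col c) = []"
| "kids s (Opr y) = map Col (s y)"
| "kids s (Node xs y) = xs"

definition graft :: "nat \<Rightarrow> ('c, 'o) lev list \<Rightarrow> 'o \<Rightarrow> ('c, 'o) lev" where
  "graft n xs y = (if n = 1 then Opr y else Node xs y)"

text \<open>
  Levels are numbered from the leaves.  For \<open>0 \<le> i < n\<close>, \<open>lface s t m n i : Q\<^sub>n \<rightarrow> Q\<^bsub>n-1\<^esub>\<close> discards
  level \<open>1\<close> keeping outputs if \<open>i = 0\<close>, and composes levels \<open>i\<close> and \<open>i + 1\<close> if \<open>i > 0\<close>.  The recursion
  descends from the root, which is level \<open>n\<close>.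
\<close>

fun lface :: "('o \<Rightarrow> 'c list) \<Rightarrow> ('o \<Rightarrow> 'c) \<Rightarrow> ('o list \<times> 'o \<Rightarrow> 'o) \<Rightarrow> nat \<Rightarrow> nat
    \<Rightarrow> ('c, 'o) lev \<Rightarrow> ('c, 'o) lev" where
  "lface s t m 0 i x = x"
| "lface s t m (Suc n) i x =
     (if n = 0 then Col (t (root_op x))
      else if i = n then graft n (concat (map (kids s) (kids s x))) (m (map root_op (kids s x), root_op x))
      else graft n (map (lface s t m n i) (kids s x)) (root_op x))"

text \<open>For \<open>0 \<le> i \<le> n\<close>, \<open>ldegen s t e n i : Q\<^sub>n \<rightarrow> Q\<^bsub>n+1\<^esub>\<close> inserts a new level \<open>i + 1\<close> of units.\<close>

fun ldegen :: "('o \<Rightarrow> 'c list) \<Rightarrow> ('o \<Rightarrow> 'c) \<Rightarrow> ('c \<Rightarrow> 'o) \<Rightarrow> nat \<Rightarrow> nat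
    \<Rightarrow> ('c, 'o) lev \<Rightarrow> ('c, 'o) lev" where
  "ldegen s t e 0 i x = Opr (e (the_col x))"
| "ldegen s t e (Suc n) i x =
     (if i = Suc n then Node [x] (e (t (root_op x)))
      else Node (map (ldegen s t e n i) (kids s x)) (root_op x))"

text \<open>
  The data of a simplicial groupoid: \<open>face X n i : X\<^sub>n \<rightarrow> X\<^bsub>n-1\<^esub>\<close> is \<open>d\<^sub>i\<close> and
  \<open>degen X n i : X\<^sub>n \<rightarrow> X\<^bsub>n+1\<^esub>\<close> is \<open>s\<^sub>i\<close>.
\<close>

record ('o, 'a) sgpd =
  nsimp :: "nat \<Rightarrow> ('o, 'a) gpd"
  face :: "nat \<Rightarrow> nat \<Rightarrow> ('o, 'a, 'o, 'a) fnc"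
  degen :: "nat \<Rightarrow> nat \<Rightarrow> ('o, 'a, 'o, 'a) fnc"

definition bar_face :: "('o \<Rightarrow> 'c list) \<Rightarrow> ('o \<Rightarrow> 'c) \<Rightarrow> ('o list \<times> 'o \<Rightarrow> 'o) \<Rightarrow> nat \<Rightarrow> nat
    \<Rightarrow> ('c, 'o) lev list \<Rightarrow> ('c, 'o) lev list" where
  "bar_face s t m n i xs =
     (if i = n then concat (map (kids s) xs) else map (lface s t m n i) xs)"

definition bar :: "('c, 'ca, 'o, 'oa) operad \<Rightarrow> (('c, 'o) lev list, ('ca, 'oa) lev list) sgpd" where
  "bar Q = \<lparr>nsimp = (\<lambda>n. Mr (Qn Q n)),
     face = (\<lambda>n i. \<lparr>fob = bar_face (fob (src Q)) (fob (tgt Q)) (fob (com Q)) n i,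
                    far = bar_face (far (src Q)) (far (tgt Q)) (far (com Q)) n i\<rparr>),
     degen = (\<lambda>n i. \<lparr>fob = map (ldegen (fob (src Q)) (fob (tgt Q)) (fob (unt Q)) n i),
                     far = map (ldegen (far (src Q)) (far (tgt Q)) (far (unt Q)) n i)\<rparr>)\<rparr>"

section \<open>Bialgebras with a basis\<close>

text \<open>
  \<open>'b \<Rightarrow>\<^sub>0 rat\<close> restricted to keys in \<open>B\<close> is the rational vector space with basis \<open>B\<close>, and
  \<open>'b \<times> 'b \<Rightarrow>\<^sub>0 rat\<close> with keys in \<open>B \<times> B\<close> is its tensor square.  Structure maps are given on
  basis elements and extended (bi)linearly.
\<close>

definition lin_span :: "'b set \<Rightarrow> ('b \<Rightarrow>\<^sub>0 rat) set" where
  "lin_span B = {v. Poly_Mapping.keys v \<subseteq> B}"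

definition scale :: "rat \<Rightarrow> ('b \<Rightarrow>\<^sub>0 rat) \<Rightarrow> ('b \<Rightarrow>\<^sub>0 rat)" where
  "scale r v = Poly_Mapping.map ((*) r) v"

definition lin_ext :: "('b \<Rightarrow> ('d \<Rightarrow>\<^sub>0 rat)) \<Rightarrow> ('b \<Rightarrow>\<^sub>0 rat) \<Rightarrow> ('d \<Rightarrow>\<^sub>0 rat)" where
  "lin_ext f v = (\<Sum>b\<in>Poly_Mapping.keys v. scale (Poly_Mapping.lookup v b) (f b))"

definition lin_form :: "('b \<Rightarrow> rat) \<Rightarrow> ('b \<Rightarrow>\<^sub>0 rat) \<Rightarrow> rat" where
  "lin_form f v = (\<Sum>b\<in>Poly_Mapping.keys v. Poly_Mapping.lookup v b * f b)"

definition bilin_ext ::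
  "('b \<Rightarrow> 'd \<Rightarrow> ('e \<Rightarrow>\<^sub>0 rat)) \<Rightarrow> ('b \<Rightarrow>\<^sub>0 rat) \<Rightarrow> ('d \<Rightarrow>\<^sub>0 rat) \<Rightarrow> ('e \<Rightarrow>\<^sub>0 rat)" where
  "bilin_ext f v w = lin_ext (\<lambda>a. lin_ext (f a) w) v"

definition bvec :: "'b \<Rightarrow> ('b \<Rightarrow>\<^sub>0 rat)" where
  "bvec b = Poly_Mapping.single b 1"

definition tensor :: "('b \<Rightarrow>\<^sub>0 rat) \<Rightarrow> ('d \<Rightarrow>\<^sub>0 rat) \<Rightarrow> ('b \<times> 'd \<Rightarrow>\<^sub>0 rat)" where
  "tensor = bilin_ext (\<lambda>a b. bvec (a, b))"

record 'b bialg =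
  basis :: "'b set"
  mult :: "'b \<Rightarrow> 'b \<Rightarrow> ('b \<Rightarrow>\<^sub>0 rat)"
  unit :: "'b \<Rightarrow>\<^sub>0 rat"
  comult :: "'b \<Rightarrow> ('b \<times> 'b \<Rightarrow>\<^sub>0 rat)"
  counit :: "'b \<Rightarrow> rat"

definition tensor_mult ::
  "'b bialg \<Rightarrow> ('b \<times> 'b \<Rightarrow>\<^sub>0 rat) \<Rightarrow> ('b \<times> 'b \<Rightarrow>\<^sub>0 rat) \<Rightarrow> ('b \<times> 'b \<Rightarrow>\<^sub>0 rat)" where
  "tensor_mult A = bilin_ext (\<lambda>(a, b) (c, d). tensor (mult A a c) (mult A b d))"

definition bialgebra :: "'b bialg \<Rightarrow> bool" where
  "bialgebra A \<longleftrightarrow>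
     unit A \<in> lin_span (basis A) \<and>
     (\<forall>a\<in>basis A. \<forall>b\<in>basis A. mult A a b \<in> lin_span (basis A)) \<and>
     (\<forall>a\<in>basis A. comult A a \<in> lin_span (basis A \<times> basis A)) \<and>
     (\<forall>a\<in>basis A. \<forall>b\<in>basis A. \<forall>c\<in>basis A.
        bilin_ext (mult A) (mult A a b) (bvec c) = bilin_ext (mult A) (bvec a) (mult A b c)) \<and>
     (\<forall>a\<in>basis A. bilin_ext (mult A) (unit A) (bvec a) = bvec a \<and>
        bilin_ext (mult A) (bvec a) (unit A) = bvec a) \<and>
     (\<forall>a\<in>basis A.
        lin_ext (\<lambda>((x, y), z). bvec (x, y, z))
          (lin_ext (\<lambda>(x, y). tensor (comult A x) (bvec y)) (comult A a)) =
        lin_ext (\<lambda>(x, y). tensor (bvec x) (comult A y)) (comult A a)) \<and>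
     (\<forall>a\<in>basis A. lin_ext (\<lambda>(x, y). scale (counit A x) (bvec y)) (comult A a) = bvec a \<and>
        lin_ext (\<lambda>(x, y). scale (counit A y) (bvec x)) (comult A a) = bvec a) \<and>
     (\<forall>a\<in>basis A. \<forall>b\<in>basis A.
        lin_ext (comult A) (mult A a b) = tensor_mult A (comult A a) (comult A b)) \<and>
     lin_ext (comult A) (unit A) = tensor (unit A) (unit A) \<and>
     (\<forall>a\<in>basis A. \<forall>b\<in>basis A. lin_form (counit A) (mult A a b) = counit A a * counit A b) \<and>
     lin_form (counit A) (unit A) = 1"

text \<open>Isomorphisms are arbitrary linear ones; they need not respect the chosen bases.\<close>

definition bialgebra_iso :: "'b bialg \<Rightarrow> 'd bialg \<Rightarrow> ('b \<Rightarrow> ('d \<Rightarrow>\<^sub>0 rat)) \<Rightarrow> bool" where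
  "bialgebra_iso A B \<phi> \<longleftrightarrow>
     bij_betw (lin_ext \<phi>) (lin_span (basis A)) (lin_span (basis B)) \<and>
     (\<forall>a\<in>basis A. \<forall>b\<in>basis A.
        lin_ext \<phi> (mult A a b) = bilin_ext (mult B) (\<phi> a) (\<phi> b)) \<and>
     lin_ext \<phi> (unit A) = unit B \<and>
     (\<forall>a\<in>basis A.
        lin_ext (\<lambda>(x, y). tensor (\<phi> x) (\<phi> y)) (comult A a) = lin_ext (comult B) (\<phi> a)) \<and>
     (\<forall>a\<in>basis A. counit A a = lin_form (counit B) (\<phi> a))"

definition bialgebra_isomorphic :: "'b bialg \<Rightarrow> 'd bialg \<Rightarrow> bool" where
  "bialgebra_isomorphic A B \<longleftrightarrow> bialgebra A \<and> bialgebra B \<and> (\<exists>\<phi>. bialgebra_iso A B \<phi>)"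

section \<open>The incidence bialgebra\<close>

text \<open>
  The finiteness condition under which the homotopy cardinalities below are finite, and under which
  the comultiplication is a finite sum.
\<close>

definition locally_finite :: "('o, 'a) sgpd \<Rightarrow> bool" where
  "locally_finite X \<longleftrightarrow>
     (\<forall>f\<in>Obj (nsimp X 1). finite (Aut (nsimp X 1) f) \<and>
        finite_gpd (hfib (face X 2 1) (nsimp X 2) (nsimp X 1) f) \<and>
        finite_gpd (hfib (degen X 0 0) (nsimp X 0) (nsimp X 1) f))"

definition d2_d0 :: "('o, 'a) sgpd \<Rightarrow> ('o, 'a, 'o \<times> 'o, 'a \<times> 'a) fnc" where
  "d2_d0 X = \<lparr>fob = (\<lambda>x. (fob (face X 2 2) x, fob (face X 2 0) x)),
              far = (\<lambda>x. (far (face X 2 2) x, far (face X 2 0) x))\<rparr>"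

definition Phi :: "('o, 'a) sgpd \<Rightarrow> 'o \<Rightarrow> 'o \<Rightarrow> 'o \<Rightarrow> _" where
  "Phi X f a b =
     hfib (fcomp (d2_d0 X) hfib_proj)
       (hfib (face X 2 1) (nsimp X 2) (nsimp X 1) f)
       (prod_gpd (nsimp X 1) (nsimp X 1)) (a, b)"

definition inc_coeff :: "('o, 'a) sgpd \<Rightarrow> 'o set \<Rightarrow> 'o set \<Rightarrow> 'o set \<Rightarrow> rat" where
  "inc_coeff X f a b =
     hcard (Phi X (rep f) (rep a) (rep b)) /
       (of_nat (card (Aut (nsimp X 1) (rep a))) * of_nat (card (Aut (nsimp X 1) (rep b))))"

text \<open>
  The basis consists of \<open>Some a\<close> (that is, \<open>\<delta>\<^sub>a\<close>) for \<open>a \<in> \<pi>\<^sub>0 X\<^sub>1\<close> together with the adjoined unit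
  \<open>None\<close>; simplices are sequences, multiplied by concatenation.
\<close>

definition incidence_bialgebra :: "('o list, 'a list) sgpd \<Rightarrow> 'o list set option bialg" where
  "incidence_bialgebra X = \<lparr>
     basis = insert None (Some ` pi0 (nsimp X 1)),
     mult = (\<lambda>u v. case u of None \<Rightarrow> bvec v
               | Some a \<Rightarrow> (case v of None \<Rightarrow> bvec u
                   | Some b \<Rightarrow> bvec (Some (iso_class (nsimp X 1) (rep a @ rep b))))),
     unit = bvec None,
     comult = (\<lambda>u. case u of None \<Rightarrow> bvec (None, None)
               | Some f \<Rightarrow> (\<Sum>(a, b)\<in>{(a, b). a \<in> pi0 (nsimp X 1) \<and> b \<in> pi0 (nsimp X 1) \<and>
                                  inc_coeff X f a b \<noteq> 0}.
                              scale (inc_coeff X f a b) (bvec (Some a, Some b)))),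
     counit = (\<lambda>u. case u of None \<Rightarrow> 1
               | Some f \<Rightarrow> hcard (hfib (degen X 0 0) (nsimp X 0) (nsimp X 1) (rep f)))\<rparr>"

section \<open>Noncommutative power series and plethystic substitution\<close>

definition words :: "nat list set" where
  "words = {w. w \<noteq> [] \<and> (\<forall>k\<in>set w. 0 < k)}"

text \<open>
  A power series in noncommuting variables with coefficients in \<open>'r\<close> is its coefficient function
  \<open>nat list \<Rightarrow> 'r\<close>; those considered here (no constant term, variables \<open>x\<^sub>1, x\<^sub>2, \<dots>\<close>) vanish outside
  \<^const>\<open>words\<close>.
\<close>

definition series :: "(nat list \<Rightarrow> 'r::ring_1) set" where
  "series = {F. \<forall>w. w \<notin> words \<longrightarrow> F w = 0}"

definition ser_mult :: "(nat list \<Rightarrow> 'r::ring_1) \<Rightarrow> (nat list \<Rightarrow> 'r) \<Rightarrow> nat list \<Rightarrow> 'r" where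
  "ser_mult F G w = (\<Sum>(u, v) | u @ v = w. F u * G v)"

definition ser_one :: "nat list \<Rightarrow> 'r::ring_1" where
  "ser_one w = (if w = [] then 1 else 0)"

definition ser_var :: "nat \<Rightarrow> nat list \<Rightarrow> 'r::ring_1" where
  "ser_var k w = (if w = [k] then 1 else 0)"

text \<open>\<open>ser_dil k F\<close> is \<open>F\<^sub>k = F(x\<^sub>k, x\<^bsub>2k\<^esub>, \<dots>)\<close> for \<open>k \<ge> 1\<close>.\<close>

definition ser_dil :: "nat \<Rightarrow> (nat list \<Rightarrow> 'r::ring_1) \<Rightarrow> nat list \<Rightarrow> 'r" where
  "ser_dil k F w = (\<Sum>v | map ((*) k) v = w. F v)"

text \<open>
  \<open>pleth G F = G(F\<^sub>1, F\<^sub>2, \<dots>)\<close>, the sum over \<open>v\<close> of \<open>g\<^sub>v F\<^bsub>v\<^sub>1\<^esub> \<cdots> F\<^bsub>v\<^sub>n\<^esub>\<close>; for \<open>F\<close> and \<open>G\<close> in \<^const>\<open>series\<close>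
  only finitely many summands contribute to each coefficient.
\<close>

definition pleth :: "(nat list \<Rightarrow> 'r::ring_1) \<Rightarrow> (nat list \<Rightarrow> 'r) \<Rightarrow> nat list \<Rightarrow> 'r" where
  "pleth G F w = (\<Sum>v. G v * foldr ser_mult (map (\<lambda>k. ser_dil k F) v) ser_one w)"

section \<open>The noncommutative linear plethystic bialgebra with noncommuting variables\<close>

text \<open>
  The free monoid, written additively so that \<open>'a fmon \<Rightarrow>\<^sub>0 rat\<close> is the free associative unital
  algebra and \<open>'a fmon \<times> 'a fmon \<Rightarrow>\<^sub>0 rat\<close> its tensor square, as rings.
\<close>

datatype 'a fmon = FMon (letters: "'a list")

instantiation fmon :: (type) monoid_add
begin

definition "0 = FMon []"
definition "u + v = FMon (letters u @ letters v)"

instance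
  by standard (simp_all add: zero_fmon_def plus_fmon_def)

end

type_synonym tensor_ring = "nat list fmon \<times> nat list fmon \<Rightarrow>\<^sub>0 rat"

text \<open>
  The defining property \<open>\<Delta>(a\<^sub>\<omega>)(F, G) = a\<^sub>\<omega>(G \<circledast> F)\<close> is imposed on the universal pair of series, with
  coefficients in the tensor square: \<open>F\<close> has coefficients \<open>a\<^sub>\<omega> \<otimes> 1\<close> and \<open>G\<close> has coefficients
  \<open>1 \<otimes> a\<^sub>\<omega>\<close>.
\<close>

definition univ_F :: "nat list \<Rightarrow> tensor_ring" where
  "univ_F w = (if w \<in> words then Poly_Mapping.single (FMon [w], 0) 1 else 0)"

definition univ_G :: "nat list \<Rightarrow> tensor_ring" where
  "univ_G w = (if w \<in> words then Poly_Mapping.single (0, FMon [w]) 1 else 0)"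

definition comult_gen :: "nat list \<Rightarrow> tensor_ring" where
  "comult_gen w = pleth univ_G univ_F w"

text \<open>
  Evaluation \<open>a \<otimes> b \<mapsto> b(G) a(F)\<close> of the tensor square at a pair of series over a ring \<open>'r\<close>, with
  rational scalars acting through \<open>\<iota>\<close>.  The order of the factors is the one in which the coefficients
  of \<open>G\<close> and \<open>F\<close> occur in \<open>G \<circledast> F\<close>; it matters because \<open>'r\<close> need not be commutative.
\<close>

definition eval_pair :: "(rat \<Rightarrow> 'r) \<Rightarrow> (nat list \<Rightarrow> 'r) \<Rightarrow> (nat list \<Rightarrow> 'r) \<Rightarrow> tensor_ring \<Rightarrow> 'r::ring_1" where
  "eval_pair \<iota> F G T = (\<Sum>(u, v)\<in>Poly_Mapping.keys T. \<iota> (Poly_Mapping.lookup T (u, v)) *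
     prod_list (map G (letters v)) * prod_list (map F (letters u)))"

lemma ser_prod_bound:
  assumes "F \<in> series" "foldr ser_mult (map (\<lambda>k. ser_dil k F) v) ser_one w \<noteq> 0"
  shows "length v \<le> length w \<and> (\<forall>k\<in>set v. k \<le> sum_list w)"
  using assms(2)
proof (induction v arbitrary: w)
  case Nil
  then show ?case by simp
next
  case (Cons k v)
  let ?P = "foldr ser_mult (map (\<lambda>k. ser_dil k F) v) ser_one"
  from Cons.prems have "(\<Sum>p | fst p @ snd p = w. ser_dil k F (fst p) * ?P (snd p)) \<noteq> 0"
    by (simp add: ser_mult_def[of "ser_dil k F"] case_prod_unfold)
  then obtain p where p: "p \<in> {p. fst p @ snd p = w}" "ser_dil k F (fst p) * ?P (snd p) \<noteq> 0"
    by (rule sum.not_neutral_contains_not_neutral)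
  define a b where "a = fst p" and "b = snd p"
  have ab: "a @ b = w" "ser_dil k F a \<noteq> 0" "?P b \<noteq> 0"
    using p by (auto simp: a_def b_def)
  from ab(2) obtain u where "u \<in> {u. map ((*) k) u = a}" "F u \<noteq> 0"
    unfolding ser_dil_def by (rule sum.not_neutral_contains_not_neutral)
  then have u: "map ((*) k) u = a" "F u \<noteq> 0" by simp_all
  from u(2) have "u \<in> words" using assms(1) unfolding series_def by blast
  then obtain h t where ht: "u = h # t" "h > 0" by (cases u) (auto simp: words_def)
  have "k \<le> k * h" using ht by simp
  then have "k \<le> sum_list a"
    unfolding u(1)[symmetric] ht(1) list.map sum_list.Cons by (rule trans_le_add1)
  moreover have "length a \<ge> 1"
    unfolding u(1)[symmetric] ht(1) by simp
  moreover have "sum_list w = sum_list a + sum_list b" "length w = length a + length b"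
    unfolding ab(1)[symmetric] by simp_all
  ultimately show ?case using Cons.IH[OF ab(3)] by (auto intro: trans_le_add2)
qed

context
  fixes \<iota> :: "rat \<Rightarrow> 'r::ring_1" and F G :: "nat list \<Rightarrow> 'r"
  assumes i1: "\<iota> 1 = 1" and iadd: "\<And>a b. \<iota> (a + b) = \<iota> a + \<iota> b"
    and icomm: "\<And>a r. \<iota> a * r = r * \<iota> a"
    and FS: "F \<in> series" and GS: "G \<in> series"
begin

lemma coeff_hom_0: "\<iota> 0 = 0" using iadd[of 0 0] by simp

lemma eval_superset:
  assumes "finite K" "Poly_Mapping.keys T \<subseteq> K"
  shows "eval_pair \<iota> F G T = (\<Sum>(u, v)\<in>K. \<iota> (Poly_Mapping.lookup T (u, v)) *
     prod_list (map G (letters v)) * prod_list (map F (letters u)))"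
  unfolding eval_pair_def by (rule sum.mono_neutral_left) (use assms in \<open>auto simp: coeff_hom_0 in_keys_iff\<close>)

lemma eval_add: "eval_pair \<iota> F G (S + T) = eval_pair \<iota> F G S + eval_pair \<iota> F G T"
proof -
  let ?K = "Poly_Mapping.keys S \<union> Poly_Mapping.keys T"
  have *: "eval_pair \<iota> F G U = (\<Sum>(u, v)\<in>?K. \<iota> (Poly_Mapping.lookup U (u, v)) *
     prod_list (map G (letters v)) * prod_list (map F (letters u)))" if "Poly_Mapping.keys U \<subseteq> ?K" for U
    by (rule eval_superset) (use that in auto)
  show ?thesis
    by (simp add: * Poly_Mapping.keys_add sum.distrib[symmetric] lookup_add iadd distrib_right case_prod_unfold)
qed

lemma eval_0: "eval_pair \<iota> F G 0 = 0" by (simp add: eval_pair_def)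

lemma eval_sum: "eval_pair \<iota> F G (sum f A) = (\<Sum>a\<in>A. eval_pair \<iota> F G (f a))"
  by (induction A rule: infinite_finite_induct) (auto simp: eval_0 eval_add)

lemma eval_single: "eval_pair \<iota> F G (Poly_Mapping.single (u, v) c) = \<iota> c *
     prod_list (map G (letters v)) * prod_list (map F (letters u))"
  by (subst eval_superset[of "{(u, v)}"]) auto

lemma as_sum: "T = (\<Sum>k\<in>Poly_Mapping.keys T. Poly_Mapping.single k (Poly_Mapping.lookup T k))" for T :: tensor_ring
  by (rule poly_mapping_eqI) (auto simp: lookup_sum lookup_single when_def in_keys_iff)

lemma eval_G: "eval_pair \<iota> F G (univ_G x * T) = G x * eval_pair \<iota> F G T"
proof (cases "x \<in> words")
  case True
  have "eval_pair \<iota> F G (univ_G x * T) =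
    (\<Sum>(u, v)\<in>Poly_Mapping.keys T. eval_pair \<iota> F G (Poly_Mapping.single (u, FMon [x] + v) (Poly_Mapping.lookup T (u, v))))"
    by (subst as_sum[of T], unfold sum_distrib_left eval_sum)
      (rule sum.cong, use True in \<open>auto simp: univ_G_def mult_single\<close>)
  also have "\<dots> = G x * eval_pair \<iota> F G T"
    unfolding eval_pair_def sum_distrib_left
    by (rule sum.cong)
      (auto simp: eval_single plus_fmon_def mult.assoc[symmetric] icomm[of _ "G x", symmetric])
  finally show ?thesis .
qed (use GS in \<open>auto simp: univ_G_def series_def eval_0\<close>)

lemma eval_F:
  assumes "Poly_Mapping.keys T \<subseteq> UNIV \<times> {0}"
  shows "eval_pair \<iota> F G (univ_F x * T) = F x * eval_pair \<iota> F G T"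
proof (cases "x \<in> words")
  case True
  have "eval_pair \<iota> F G (univ_F x * T) =
    (\<Sum>(u, v)\<in>Poly_Mapping.keys T. eval_pair \<iota> F G (Poly_Mapping.single (FMon [x] + u, v) (Poly_Mapping.lookup T (u, v))))"
    by (subst as_sum[of T], unfold sum_distrib_left eval_sum)
      (rule sum.cong, use True in \<open>auto simp: univ_F_def mult_single\<close>)
  also have "\<dots> = F x * eval_pair \<iota> F G T"
    unfolding eval_pair_def sum_distrib_left
    by (rule sum.cong)
      (use assms in \<open>auto simp: eval_single plus_fmon_def zero_fmon_def mult.assoc[symmetric]
         icomm[of _ "F x", symmetric] dest!: subsetD\<close>)
  finally show ?thesis .
qed (use FS in \<open>auto simp: univ_F_def series_def eval_0\<close>)

lemma eval_prod:
  "Poly_Mapping.keys (foldr ser_mult (map (\<lambda>k. ser_dil k univ_F) v) ser_one w) \<subseteq> UNIV \<times> {0} \<and>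
   eval_pair \<iota> F G (foldr ser_mult (map (\<lambda>k. ser_dil k univ_F) v) ser_one w) =
   foldr ser_mult (map (\<lambda>k. ser_dil k F) v) ser_one w"
proof (induction v arbitrary: w)
  case Nil
  have one: "(1::tensor_ring) = Poly_Mapping.single (0,0) 1" by (simp add: zero_prod_def[symmetric])
  have "eval_pair \<iota> F G 1 = 1" by (subst one, subst eval_single) (simp add: i1 zero_fmon_def)
  then show ?case by (auto simp: ser_one_def eval_0 zero_prod_def)
next
  case (Cons k v)
  let ?P = "foldr ser_mult (map (\<lambda>k. ser_dil k univ_F) v) ser_one"
  have dk: "Poly_Mapping.keys (univ_F u * T) \<subseteq> UNIV \<times> {0}" if "Poly_Mapping.keys T \<subseteq> UNIV \<times> {0}" for u T
    using that keys_mult[of "univ_F u" T] by (fastforce simp: univ_F_def split: if_splits)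
  have ks: "Poly_Mapping.keys (sum f A) \<subseteq> S" if "\<And>a. a \<in> A \<Longrightarrow> Poly_Mapping.keys (f a) \<subseteq> S"
    for f :: "'x \<Rightarrow> tensor_ring" and A S
    using keys_sum[of f A] that by blast
  have eq: "ser_mult (ser_dil k univ_F) ?P w =
     (\<Sum>(a, b) | a @ b = w. \<Sum>u | map ((*) k) u = a. univ_F u * ?P b)"
    by (simp add: ser_mult_def[of "ser_dil k univ_F"] ser_dil_def[of k univ_F] sum_distrib_right)
  have "Poly_Mapping.keys (ser_mult (ser_dil k univ_F) ?P w) \<subseteq> UNIV \<times> {0}"
    unfolding eq case_prod_unfold using dk Cons.IH by (intro ks) blast
  moreover have "eval_pair \<iota> F G (ser_mult (ser_dil k univ_F) ?P w) =
     (\<Sum>(a, b) | a @ b = w. \<Sum>u | map ((*) k) u = a. F u * foldr ser_mult (map (\<lambda>k. ser_dil k F) v) ser_one b)"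
    unfolding eq eval_sum case_prod_unfold
    by (intro sum.cong refl) (simp add: eval_F Cons.IH)
  moreover have "\<dots> = ser_mult (ser_dil k F) (foldr ser_mult (map (\<lambda>k. ser_dil k F) v) ser_one) w"
    by (simp add: ser_mult_def[of "ser_dil k F"] ser_dil_def[of k F] sum_distrib_right)
  ultimately show ?case by simp
qed

text \<open>The defining property of the comultiplication, for an arbitrary ring and arbitrary series.\<close>

lemma comult_gen_eval: "eval_pair \<iota> F G (comult_gen w) = pleth G F w"
proof -
  let ?V = "{v. set v \<subseteq> {..sum_list w} \<and> length v \<le> length w}"
  have fin: "finite ?V" by (rule finite_lists_length_le) simp
  have uF: "univ_F \<in> series" by (simp add: univ_F_def series_def)
  have "comult_gen w = (\<Sum>v\<in>?V. univ_G v * foldr ser_mult (map (\<lambda>k. ser_dil k univ_F) v) ser_one w)"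
    unfolding comult_gen_def pleth_def
    by (rule Sum_any.expand_superset[OF fin]) (auto dest!: mult_not_zero ser_prod_bound[OF uF])
  then have "eval_pair \<iota> F G (comult_gen w) = (\<Sum>v\<in>?V. G v * foldr ser_mult (map (\<lambda>k. ser_dil k F) v) ser_one w)"
    by (simp add: eval_sum eval_G eval_prod)
  also have "\<dots> = pleth G F w"
    unfolding pleth_def
    by (rule Sum_any.expand_superset[OF fin, symmetric]) (auto dest!: mult_not_zero ser_prod_bound[OF FS])
  finally show ?thesis .
qed

end

definition plethystic_bialgebra :: "nat list fmon bialg" where
  "plethystic_bialgebra = \<lparr>
     basis = {u. set (letters u) \<subseteq> words},
     mult = (\<lambda>u v. bvec (u + v)),
     unit = bvec 0,
     comult = (\<lambda>u. prod_list (map comult_gen (letters u))),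
     counit = (\<lambda>u. prod_list (map (ser_var 1) (letters u)))\<rparr>"

end

(*
  Every groupoid in the bar construction of T_Mr Ass is discrete, so all homotopy cardinalities are
  numbers of elements of strict fibres.  The 1-simplices are nonempty forests (lists of words), and a
  2-simplex is a pair (x, v) of forests in which x has one word for each letter of v; grafting
  multiplies the letters of each word of x by the corresponding letter of v.  Hence the
  comultiplication sends u to the sum of x (x) v over all factorizations of u under grafting.  The
  coefficient of x_w in G(F_1, F_2, ...) expands to the same sum, with x collecting the
  coefficients of F and v the coefficient of G.  So both algebras have a basis indexed by forests
  with the same structure constants, and the bialgebra laws become properties of grafting:
  associativity, units, and unique splitting of the factorizations of a concatenation.
*)

theory Submission
  imports Defs
begin

section \<open>Linear algebra of finitely supported functions with a chosen basis\<close>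

section \<open>Linear extension\<close>

lemma lookup_scale [simp]: "Poly_Mapping.lookup (scale r v) k = r * Poly_Mapping.lookup v k"
  by (simp add: scale_def Poly_Mapping.map.rep_eq when_def)

lemma scale_simps [simp]:
  "scale 0 v = 0" "scale 1 v = v" "scale r 0 = 0"
  "scale (r * s) v = scale r (scale s v)"
  by (rule poly_mapping_eqI; simp)+

lemma scale_add_left: "scale (r + s) v = scale r v + scale s v"
  by (rule poly_mapping_eqI) (simp add: lookup_add distrib_right)

lemma scale_add_right: "scale r (v + w) = scale r v + scale r w"
  by (rule poly_mapping_eqI) (simp add: lookup_add distrib_left)

lemma scale_sum: "scale r (sum f I) = (\<Sum>i\<in>I. scale r (f i))"
  by (induction I rule: infinite_finite_induct) (simp_all add: scale_add_right)

text \<open>Vectors with different supports can be compared only over a common finite index set; the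
  extra terms have coefficient zero.\<close>

lemma lin_ext_superset:
  assumes "finite K" "Poly_Mapping.keys v \<subseteq> K"
  shows "lin_ext f v = (\<Sum>b\<in>K. scale (Poly_Mapping.lookup v b) (f b))"
  unfolding lin_ext_def
  by (rule sum.mono_neutral_left) (use assms in \<open>auto simp: in_keys_iff\<close>)

lemma lin_ext_zero [simp]: "lin_ext f 0 = 0"
  by (simp add: lin_ext_def)

lemma lin_ext_add: "lin_ext f (v + w) = lin_ext f v + lin_ext f w"
proof -
  let ?K = "Poly_Mapping.keys v \<union> Poly_Mapping.keys w"
  have "lin_ext f u = (\<Sum>b\<in>?K. scale (Poly_Mapping.lookup u b) (f b))"
    if "Poly_Mapping.keys u \<subseteq> ?K" for u
    by (rule lin_ext_superset) (use that in auto)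
  then show ?thesis
    by (simp add: Poly_Mapping.keys_add lookup_add scale_add_left sum.distrib)
qed

lemma lin_ext_sum: "lin_ext f (sum g I) = (\<Sum>i\<in>I. lin_ext f (g i))"
  by (induction I rule: infinite_finite_induct) (simp_all add: lin_ext_add)

lemma lin_ext_bvec [simp]: "lin_ext f (bvec b) = f b"
  by (subst lin_ext_superset[of "{b}"]) (auto simp: bvec_def)

lemma lin_ext_scale: "lin_ext f (scale r v) = scale r (lin_ext f v)"
  \<comment> \<open>For \<open>r = 0\<close> the support shrinks, so the sum is kept over the
    support of \<open>v\<close>.\<close>
  by (subst lin_ext_superset[of "Poly_Mapping.keys v"])
    (auto simp: lin_ext_def scale_sum in_keys_iff)

lemma lin_ext_cong:
  "(\<And>b. b \<in> Poly_Mapping.keys v \<Longrightarrow> f b = g b) \<Longrightarrow> lin_ext f v = lin_ext g v"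
  by (simp add: lin_ext_def)

lemma lin_ext_lin_ext: "lin_ext f (lin_ext g v) = lin_ext (\<lambda>b. lin_ext f (g b)) v"
  unfolding lin_ext_def[of g] lin_ext_def[of "\<lambda>b. lin_ext f (g b)"]
  by (simp add: lin_ext_sum lin_ext_scale)

lemma lin_ext_bvec_id [simp]: "lin_ext bvec v = v"
  by (rule poly_mapping_eqI)
    (auto simp: lin_ext_def bvec_def lookup_sum lookup_single when_def in_keys_iff
       if_distrib[of "(*) _"] cong: if_cong)

lemma bilin_ext_bvec [simp]: "bilin_ext f (bvec a) (bvec b) = f a b"
  by (simp add: bilin_ext_def)

text \<open>\<open>bilin_ext\<close> expands its first argument outermost, so linearity in the
  second argument costs an interchange of two finite sums.\<close>

lemma bilin_ext_sum:
  "bilin_ext f (sum g I) (sum k J) = (\<Sum>i\<in>I. \<Sum>j\<in>J. bilin_ext f (g i) (k j))"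
proof -
  have "bilin_ext f v (sum k J) = (\<Sum>j\<in>J. bilin_ext f v (k j))" for v
    unfolding bilin_ext_def lin_ext_sum lin_ext_def[of _ v] scale_sum by (rule sum.swap)
  then show ?thesis
    by (simp add: bilin_ext_def[of f "sum g I"] lin_ext_sum)
      (simp add: bilin_ext_def[symmetric] sum.swap[of _ J])
qed

lemma bilin_ext_sum_left: "bilin_ext f (sum g I) w = (\<Sum>i\<in>I. bilin_ext f (g i) w)"
  by (simp add: bilin_ext_def lin_ext_sum)

lemma bilin_ext_sum_right: "bilin_ext f v (sum k J) = (\<Sum>j\<in>J. bilin_ext f v (k j))"
  using bilin_ext_sum[of f "\<lambda>_. v" "{()}" k J] by simp

lemma tensor_bvec [simp]: "tensor (bvec a) (bvec b) = bvec (a, b)"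
  by (simp add: tensor_def)

lemma lin_form_bvec [simp]: "lin_form f (bvec b) = f b"
  by (simp add: lin_form_def bvec_def)

lemma keys_bvec [simp]: "Poly_Mapping.keys (bvec b) = {b}"
  by (simp add: bvec_def)

lemma bvec_in_lin_span [simp]: "bvec b \<in> lin_span B \<longleftrightarrow> b \<in> B"
  by (simp add: lin_span_def)

lemma lin_span_zero [simp]: "0 \<in> lin_span B"
  by (simp add: lin_span_def)

lemma lin_span_add: "v \<in> lin_span B \<Longrightarrow> w \<in> lin_span B \<Longrightarrow> v + w \<in> lin_span B"
  using Poly_Mapping.keys_add[of v w] by (auto simp: lin_span_def)

lemma lin_span_sum: "(\<And>i. i \<in> I \<Longrightarrow> f i \<in> lin_span B) \<Longrightarrow> sum f I \<in> lin_span B"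
  by (induction I rule: infinite_finite_induct) (simp_all add: lin_span_add)

lemma lin_span_scale: "v \<in> lin_span B \<Longrightarrow> scale r v \<in> lin_span B"
  by (auto simp: lin_span_def in_keys_iff)

lemma lin_ext_in_lin_span:
  "v \<in> lin_span A \<Longrightarrow> (\<And>a. a \<in> A \<Longrightarrow> f a \<in> lin_span B) \<Longrightarrow> lin_ext f v \<in> lin_span B"
  unfolding lin_ext_def by (intro lin_span_sum lin_span_scale) (auto simp: lin_span_def)

text \<open>The inverse is the linear extension of the inverse bijection of the bases; either
  composite agrees with \<open>lin_ext bvec\<close>, the identity, on the support of the
  vector.\<close>

lemma bij_betw_lin_ext:
  assumes "bij_betw h A B"
  shows "bij_betw (lin_ext (\<lambda>a. bvec (h a))) (lin_span A) (lin_span B)"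
proof (rule bij_betw_byWitness[where f' = "lin_ext (\<lambda>b. bvec (inv_into A h b))"])
  have "lin_ext (\<lambda>b. bvec (k b)) (lin_ext (\<lambda>a. bvec (l a)) v) = v"
    if "v \<in> lin_span C" "\<And>a. a \<in> C \<Longrightarrow> k (l a) = a" for v C and k :: "'e \<Rightarrow> 'f" and l
  proof -
    have "lin_ext (\<lambda>b. bvec (k b)) (lin_ext (\<lambda>a. bvec (l a)) v) = lin_ext bvec v"
      unfolding lin_ext_lin_ext lin_ext_bvec
      by (rule lin_ext_cong) (use that in \<open>auto simp: lin_span_def\<close>)
    then show ?thesis by simp
  qed
  note * = this
  show "\<forall>v\<in>lin_span A. lin_ext (\<lambda>b. bvec (inv_into A h b)) (lin_ext (\<lambda>a. bvec (h a)) v) = v"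
    using * bij_betw_inv_into_left[OF assms] by blast
  show "\<forall>v\<in>lin_span B. lin_ext (\<lambda>a. bvec (h a)) (lin_ext (\<lambda>b. bvec (inv_into A h b)) v) = v"
    using * bij_betw_inv_into_right[OF assms] by blast
  show "lin_ext (\<lambda>a. bvec (h a)) ` lin_span A \<subseteq> lin_span B"
    using bij_betwE[OF assms] by (auto intro!: lin_ext_in_lin_span)
  show "lin_ext (\<lambda>b. bvec (inv_into A h b)) ` lin_span B \<subseteq> lin_span A"
    using bij_betwE[OF bij_betw_inv_into[OF assms]] by (auto intro!: lin_ext_in_lin_span)
qed

section \<open>Grafting of forests: associativity and units\<close>

section \<open>Composition of forests\<close>

text \<open>Operadic composition in \<open>T_Mr Ass\<close>, with arities written as numbers.
  Dilating the word grafted on a letter \<open>k\<close> by \<open>k\<close> is also what passing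
  from F to F_k does to a monomial.\<close>

definition compose :: "nat list list \<Rightarrow> nat list \<Rightarrow> nat list" where
  "compose x v = concat (map2 (\<lambda>g k. map ((*) k) g) x v)"

lemma compose_simps [simp]:
  "compose [] v = []" "compose x [] = []"
  "compose (g # x) (k # v) = map ((*) k) g @ compose x v"
  by (simp_all add: compose_def)

text \<open>The zip inside \<open>compose\<close> drops surplus words, so
  \<open>graft_forest\<close> can hand over the whole remaining list without a
  \<open>take\<close>.\<close>

lemma compose_append [simp]: "length x = length v \<Longrightarrow> compose (x @ y) v = compose x v"
  by (simp add: compose_def zip_append1)

text \<open>Associativity of multiplication of numbers; the only arithmetic behind associativity of
  grafting.\<close>

lemma map_mult_compose: "map ((*) k) (compose x v) = compose x (map ((*) k) v)"
  by (induction x v rule: list_induct2') (simp_all add: mult.assoc)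

lemma compose_append2:
  "length x = length v \<Longrightarrow> compose (x @ y) (v @ w) = compose x v @ compose y w"
  by (simp add: compose_def)

lemma length_compose: "length x = length v \<Longrightarrow> length (compose x v) = length (concat x)"
  by (induction x v rule: list_induct2) simp_all

text \<open>The words of the first forest are consumed from the left, one for each letter of the
  second. This models the inner face of a 2-simplex when the number of words matches the number of
  letters.\<close>

fun graft_forest :: "nat list list \<Rightarrow> nat list list \<Rightarrow> nat list list" where
  "graft_forest x [] = []"
| "graft_forest x (v # vs) = compose x v # graft_forest (drop (length v) x) vs"

lemma length_graft_forest [simp]: "length (graft_forest x y) = length y"
  by (induction y arbitrary: x) simp_all

text \<open>Every induction on the root forest cuts the leafward forest at the end of the first root
  word.\<close>

lemma split_forest:
  assumes "length x = length (concat (v # vs))"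
  obtains x1 x2 where "x = x1 @ x2" "length x1 = length v" "length x2 = length (concat vs)"
  using assms by (intro that[of "take (length v) x" "drop (length v) x"]) auto

lemma graft_forest_append:
  assumes "length x = length (concat u)"
  shows "graft_forest (x @ y) (u @ v) = graft_forest x u @ graft_forest y v"
  using assms
proof (induction u arbitrary: x)
  case (Cons w u)
  obtain x1 x2 where "x = x1 @ x2" "length x1 = length w" "length x2 = length (concat u)"
    using split_forest[OF Cons.prems] .
  then show ?case by (simp add: Cons.IH)
qed simp

lemma length_concat_graft_forest:
  assumes "length x = length (concat u)"
  shows "length (concat (graft_forest x u)) = length (concat x)"
  using assms
proof (induction u arbitrary: x)
  case (Cons w u)
  obtain x1 x2 where "x = x1 @ x2" "length x1 = length w" "length x2 = length (concat u)"
    using split_forest[OF Cons.prems] .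
  then show ?case using Cons.IH[of x2] by (simp add: length_compose)
qed simp

text \<open>Associativity over a single root word \<open>v\<close>: the dilation by a letter of
  \<open>v\<close> moves through the composite by \<open>map_mult_compose\<close>.\<close>

lemma compose_graft_forest:
  assumes "length y = length v" "length x = length (concat y)"
  shows "compose (graft_forest x y) v = compose x (compose y v)"
  using assms
proof (induction y v arbitrary: x rule: list_induct2)
  case (Cons w y k v)
  obtain x1 x2 where "x = x1 @ x2" "length x1 = length w" "length x2 = length (concat y)"
    using split_forest[OF Cons.prems] .
  then show ?case using Cons.IH by (simp add: map_mult_compose compose_append2)
qed simp

lemma graft_forest_assoc:
  assumes "length x = length (concat y)" "length y = length (concat z)"
  shows "graft_forest (graft_forest x y) z = graft_forest x (graft_forest y z)"
  using assms
proof (induction z arbitrary: x y)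
  case (Cons v z)
  obtain y1 y2 where y: "y = y1 @ y2" "length y1 = length v" "length y2 = length (concat z)"
    using split_forest[OF Cons.prems(2)] .
  obtain x1 x2 where x: "x = x1 @ x2" "length x1 = length (concat y1)"
      "length x2 = length (concat y2)"
    \<comment> \<open>Regarding \<open>concat y1\<close> and \<open>concat y2\<close> as two blocks
      cuts \<open>x\<close> where \<open>y\<close> was cut.\<close>
    using split_forest[of x "concat y1" "[concat y2]"] Cons.prems(1) y by auto
  \<comment> \<open>On the right-hand side the first root word is \<open>compose y1 v\<close>, and
    its length says how many words of \<open>x\<close> it consumes.\<close>
  have "length x1 = length (compose y1 v)"
    using x y by (simp add: length_compose)
  then show ?case
    using x y Cons.IH[of x2 y2] by (simp add: graft_forest_append compose_graft_forest)
qed simp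

lemma times_Suc_0 [simp]: "(*) (Suc 0) = id"
  by (simp add: fun_eq_iff)

text \<open>The word \<open>[1]\<close> is the operadic unit and, on the side of series, the
  monomial x_1.\<close>

definition unit_forest :: "nat \<Rightarrow> nat list list" where
  "unit_forest n = replicate n [1]"

lemma compose_unit_forest: "compose (unit_forest (length v)) v = v"
  by (induction v) (simp_all add: unit_forest_def)

lemma graft_forest_unit_left: "graft_forest (unit_forest (length (concat u))) u = u"
proof (induction u)
  case (Cons w u)
  have "unit_forest (length (concat (w # u)))
      = unit_forest (length w) @ unit_forest (length (concat u))"
    by (simp add: unit_forest_def replicate_add)
  moreover have "length (unit_forest (length w)) = length w"
    by (simp add: unit_forest_def)
  ultimately show ?case using Cons by (simp add: compose_unit_forest)
qed simp

lemma graft_forest_unit_right: "graft_forest u (unit_forest (length u)) = u"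
  by (induction u) (simp_all add: unit_forest_def)

section \<open>Factorizations under grafting: splitting, finiteness, units and associativity\<close>

definition forests :: "nat list list set" where
  "forests = {u. set u \<subseteq> words}"

lemma forests_simps [simp]:
  "[] \<in> forests" "w # u \<in> forests \<longleftrightarrow> w \<in> words \<and> u \<in> forests"
  "u @ v \<in> forests \<longleftrightarrow> u \<in> forests \<and> v \<in> forests"
  by (auto simp: forests_def)

lemma unit_forest_in_forests [simp]: "unit_forest n \<in> forests"
  by (auto simp: forests_def unit_forest_def words_def)

lemma compose_in_words:
  assumes "x \<in> forests" "v \<in> words" "length x = length v"
  shows "compose x v \<in> words"
proof -
  have "0 \<notin> set (compose x v)" if "0 \<notin> set v"
    using assms(3,1) that by (induction x v rule: list_induct2) (auto simp: words_def)
  moreover have "compose x v \<noteq> []"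
    using assms by (cases x; cases v) (auto simp: words_def)
  ultimately show ?thesis
    using assms(2) by (auto simp: words_def intro!: gr0I)
qed

lemma graft_forest_in_forests:
  assumes "x \<in> forests" "u \<in> forests" "length x = length (concat u)"
  shows "graft_forest x u \<in> forests"
  using assms
proof (induction u arbitrary: x)
  case (Cons w u)
  obtain x1 x2 where "x = x1 @ x2" "length x1 = length w" "length x2 = length (concat u)"
    using split_forest[OF Cons.prems(3)] .
  then show ?case using Cons by (simp add: compose_in_words)
qed simp

text \<open>The leafward factor comes first, as d_2 does in \<open>d2_d0\<close> and as the
  coefficients of F do in the tensor square.\<close>

definition factorizations :: "nat list list \<Rightarrow> (nat list list \<times> nat list list) set" where
  "factorizations u = {(x, v). x \<in> forests \<and> v \<in> forests \<and> length x = length (concat v) \<and>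
     graft_forest x v = u}"

text \<open>For a fixed monomial \<open>v\<close> of G, these are the choices of monomials of F
  whose dilations multiply to the monomial \<open>w\<close>.\<close>

definition word_factorizations :: "nat list \<Rightarrow> nat list \<Rightarrow> nat list list set" where
  "word_factorizations v w = {x. x \<in> forests \<and> length x = length v \<and> compose x v = w}"

text \<open>Grafting preserves the number of root words, so a factorization of a concatenation has
  only one place to be cut. This gives multiplicativity of the comultiplication in both
  algebras.\<close>

lemma bij_betw_factorizations_append:
  "bij_betw (\<lambda>((x, v), (x', v')). (x @ x', v @ v'))
     (factorizations u \<times> factorizations u') (factorizations (u @ u'))"
proof (rule bij_betw_imageI)
  show "inj_on (\<lambda>((x, v), (x', v')). (x @ x', v @ v')) (factorizations u \<times> factorizations u')"
  proof (rule inj_onI)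
    fix p q
    assume pq: "p \<in> factorizations u \<times> factorizations u'"
      "q \<in> factorizations u \<times> factorizations u'"
      "(\<lambda>((x, v), (x', v')). (x @ x', v @ v')) p = (\<lambda>((x, v), (x', v')). (x @ x', v @ v')) q"
    obtain x v x' v' y w y' w' where p: "p = ((x, v), x', v')" and q: "q = ((y, w), y', w')"
      by (metis surj_pair)
    \<comment> \<open>These lengths fix the cut of the root forest, and its letters then fix the cut
      of the leafward forest.\<close>
    have "length v = length u" "length w = length u"
      using pq length_graft_forest[of x v] length_graft_forest[of y w]
      by (simp_all add: p q factorizations_def)
    then show "p = q"
      using pq by (auto simp: p q factorizations_def)
  qed
  show "(\<lambda>((x, v), (x', v')). (x @ x', v @ v')) ` (factorizations u \<times> factorizations u')
      = factorizations (u @ u')"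
  proof (intro equalityI subsetI)
    fix p assume "p \<in> factorizations (u @ u')"
    then obtain x v where p: "p = (x, v)" "x \<in> forests" "v \<in> forests"
        "length x = length (concat v)" "graft_forest x v = u @ u'"
      by (auto simp: factorizations_def)
    then have "length v = length u + length u'"
      by (metis length_append length_graft_forest)
    then obtain v1 v2 where v: "v = v1 @ v2" "length v1 = length u"
      by (metis append_take_drop_id length_take min.absorb2 le_add1)
    obtain x1 x2 where x: "x = x1 @ x2" "length x1 = length (concat v1)"
        "length x2 = length (concat v2)"
      using split_forest[of x "concat v1" "[concat v2]"] p v by auto
    have "graft_forest x1 v1 = u \<and> graft_forest x2 v2 = u'"
      using p(5) x v by (simp add: graft_forest_append)
    then have "((x1, v1), (x2, v2)) \<in> factorizations u \<times> factorizations u'"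
      using p x v by (simp add: factorizations_def)
    then show "p \<in> (\<lambda>((x, v), (x', v')). (x @ x', v @ v')) `
        (factorizations u \<times> factorizations u')"
      by (rule rev_image_eqI) (simp add: p x v)
  qed (auto simp: factorizations_def graft_forest_append)
qed

lemma factorizations_Nil: "factorizations [] = {([], [])}"
proof -
  have "v = []" if "graft_forest x v = []" for x v
    using that length_graft_forest[of x v] by simp
  then show ?thesis by (fastforce simp: factorizations_def)
qed

text \<open>A one-word forest has a single root word. The root is chosen first because it governs
  the range of \<open>x\<close>, just as the sum in \<open>pleth\<close> runs over the monomials of
  G.\<close>

lemma factorizations_single:
  "factorizations [w] = (\<lambda>(v, x). (x, [v])) ` (SIGMA v:words. word_factorizations v w)"
proof -
  have "\<exists>v'. v = [v']" if "graft_forest x v = [w]" for x v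
    using that length_graft_forest[of x v] by (cases v) auto
  then show ?thesis
    by (fastforce simp: factorizations_def word_factorizations_def image_iff)
qed

text \<open>Mirrors one multiplication by F_k: \<open>a @ b = w\<close> is the split in
  \<open>ser_mult\<close>, and \<open>u\<close> is the summation index of
  \<open>ser_dil\<close>.\<close>

lemma word_factorizations_Cons:
  "word_factorizations (k # v) w =
     (\<lambda>((a, b), u, x). u # x) ` (SIGMA (a, b):{(a, b). a @ b = w}.
        {u \<in> words. map ((*) k) u = a} \<times> word_factorizations v b)"
  (is "?L = ?R")
proof
  show "?L \<subseteq> ?R"
  proof
    fix y assume "y \<in> ?L"
    then obtain u x where "y = u # x" "u \<in> words" "x \<in> word_factorizations v (compose x v)"
        "map ((*) k) u @ compose x v = w"
      by (cases y) (auto simp: word_factorizations_def)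
    then show "y \<in> ?R"
      by (intro image_eqI[of _ _ "((map ((*) k) u, compose x v), u, x)"]) auto
  qed
qed (auto simp: word_factorizations_def)

lemma finite_append_eq: "finite {(a, b). a @ b = w}"
proof (rule finite_subset)
  show "{(a, b). a @ b = w} \<subseteq> (\<lambda>n. (take n w, drop n w)) ` {..length w}"
  proof (clarify)
    fix a b assume "w = a @ b"
    then show "(a, b) \<in> (\<lambda>n. (take n (a @ b), drop n (a @ b))) ` {..length (a @ b)}"
      by (intro image_eqI[of _ _ "length a"]) auto
  qed
qed simp

lemma map_mult_eq_subset: "(k::nat) > 0 \<Longrightarrow> {u. map ((*) k) u = a} \<subseteq> {map (\<lambda>n. n div k) a}"
  by (auto intro!: map_idI[symmetric])

text \<open>A nonzero letter dilates injectively, whereas a letter 0 would send infinitely many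
  words to the same word.\<close>

lemma finite_word_factorizations:
  assumes "0 \<notin> set v"
  shows "finite (word_factorizations v w)"
  using assms
proof (induction v arbitrary: w)
  case Nil
  have "word_factorizations [] w \<subseteq> {[]}" by (auto simp: word_factorizations_def)
  then show ?case by (rule finite_subset) simp
next
  case (Cons k v)
  then have "finite {u. map ((*) k) u = a}" for a
    using map_mult_eq_subset[of k a] finite_subset by fastforce
  then have "finite {u \<in> words. map ((*) k) u = a}" for a
    by simp
  then show ?case
    unfolding word_factorizations_Cons using Cons
    by (intro finite_imageI finite_SigmaI finite_append_eq) auto
qed

text \<open>Each root letter \<open>k\<close> carries a nonempty word, which contributes at least
  one letter, and that letter is a positive multiple of \<open>k\<close>. So only finitely many
  roots are possible for a given \<open>w\<close>.\<close>

lemma word_factorizations_bound: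
  assumes "x \<in> word_factorizations v w"
  shows "set v \<subseteq> {..sum_list w}" "length v \<le> length w"
proof -
  have "length x = length v" "x \<in> forests" "compose x v = w"
    using assms by (auto simp: word_factorizations_def)
  then have "set v \<subseteq> {..sum_list w} \<and> length v \<le> length w"
  proof (induction x v arbitrary: w rule: list_induct2)
    case (Cons u x k v)
    then obtain h t where ht: "u = h # t" "h > 0" by (cases u) (auto simp: words_def)
    have "k \<le> k * h" using ht by simp
    then have "k \<le> sum_list w"
      unfolding Cons.prems(2)[symmetric] ht(1) compose_simps list.map append_Cons sum_list.Cons
      by (rule trans_le_add1)
    moreover have "set v \<subseteq> {..sum_list (compose x v)}" "length v \<le> length (compose x v)"
      using Cons by auto
    ultimately show ?case
      unfolding Cons.prems(2)[symmetric] ht(1) by (auto intro: trans_le_add2)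
  qed simp
  then show "set v \<subseteq> {..sum_list w}" "length v \<le> length w" by auto
qed

lemma finite_factorizations: "finite (factorizations u)"
proof (induction u)
  case (Cons w u)
  let ?V = "{v \<in> words. set v \<subseteq> {..sum_list w} \<and> length v \<le> length w}"
  have "finite {v. set v \<subseteq> {..sum_list w} \<and> length v \<le> length w}"
    by (rule finite_lists_length_le) simp
  then have "finite (SIGMA v:?V. word_factorizations v w)"
    by (intro finite_SigmaI finite_word_factorizations) (auto simp: words_def)
  then have "finite (factorizations [w])"
    unfolding factorizations_single
    by (rule finite_surj[where f = "\<lambda>(v, x). (x, [v])"])
      (use word_factorizations_bound in \<open>fast\<close>)
  then show ?case
    using bij_betw_finite[OF bij_betw_factorizations_append[of "[w]" u]] Cons.IH by simp
qed (simp add: factorizations_Nil)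

text \<open>The counit thus retains exactly one term of the comultiplication; the next lemma does
  the same for the other factor.\<close>

lemma factorizations_unit_left:
  assumes "u \<in> forests" "(x, v) \<in> factorizations u"
  shows "x = unit_forest (length x) \<longleftrightarrow> x = unit_forest (length (concat u)) \<and> v = u"
proof -
  have x: "length x = length (concat v)" "graft_forest x v = u"
    using assms by (auto simp: factorizations_def)
  then show ?thesis using graft_forest_unit_left[of v] by auto
qed

lemma factorizations_unit_right:
  assumes "u \<in> forests" "(x, v) \<in> factorizations u"
  shows "v = unit_forest (length v) \<longleftrightarrow> v = unit_forest (length u) \<and> x = u"
proof -
  have x: "length x = length (concat v)" "graft_forest x v = u"
    using assms by (auto simp: factorizations_def)
  moreover have "length (concat (unit_forest n)) = n" for n
    by (simp add: unit_forest_def length_concat sum_list_replicate)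
  ultimately show ?thesis
    using graft_forest_unit_right[of x] by (metis length_graft_forest)
qed

lemma unit_left_in_factorizations:
  "u \<in> forests \<Longrightarrow> (unit_forest (length (concat u)), u) \<in> factorizations u"
  by (simp add: factorizations_def graft_forest_unit_left) (simp add: unit_forest_def)

lemma unit_right_in_factorizations:
  "u \<in> forests \<Longrightarrow> (u, unit_forest (length u)) \<in> factorizations u"
  by (simp add: factorizations_def graft_forest_unit_right)
    (simp add: unit_forest_def length_concat sum_list_replicate)

text \<open>Both sides parametrize the three-level factorizations of \<open>u\<close>: one refines
  the leafward factor, the other the root factor.\<close>

lemma bij_betw_factorizations_assoc:
  "bij_betw (\<lambda>((x, v), (y, z)). ((y, graft_forest z v), (z, v)))
     (SIGMA (x, v):factorizations u. factorizations x)
     (SIGMA (x, v):factorizations u. factorizations v)"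
proof (rule bij_betw_byWitness[where f' = "\<lambda>((x, v), (y, z)). ((graft_forest x y, z), (x, y))"])
  show "\<forall>p\<in>SIGMA (x, v):factorizations u. factorizations x.
      (\<lambda>((x, v), (y, z)). ((graft_forest x y, z), (x, y)))
        ((\<lambda>((x, v), (y, z)). ((y, graft_forest z v), (z, v))) p) = p"
    by (auto simp: factorizations_def)
  show "\<forall>p\<in>SIGMA (x, v):factorizations u. factorizations v.
      (\<lambda>((x, v), (y, z)). ((y, graft_forest z v), (z, v)))
        ((\<lambda>((x, v), (y, z)). ((graft_forest x y, z), (x, y))) p) = p"
    by (auto simp: factorizations_def)
  show "(\<lambda>((x, v), (y, z)). ((y, graft_forest z v), (z, v))) `
      (SIGMA (x, v):factorizations u. factorizations x)
      \<subseteq> (SIGMA (x, v):factorizations u. factorizations v)"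
    by (auto simp: factorizations_def graft_forest_assoc length_concat_graft_forest
        graft_forest_in_forests)
  show "(\<lambda>((x, v), (y, z)). ((graft_forest x y, z), (x, y))) `
      (SIGMA (x, v):factorizations u. factorizations v)
      \<subseteq> (SIGMA (x, v):factorizations u. factorizations x)"
    by (auto simp: factorizations_def graft_forest_assoc length_concat_graft_forest
        graft_forest_in_forests)
qed

section \<open>Bialgebra laws and isomorphisms from common structure constants\<close>

section \<open>Presentations by forests\<close>

text \<open>All structure constants are fixed here, so the laws are proved once, and two algebras
  with such a presentation are isomorphic by matching indices.\<close>

definition presented_by_forests :: "'b bialg \<Rightarrow> (nat list list \<Rightarrow> 'b) \<Rightarrow> bool" where
  "presented_by_forests A h \<longleftrightarrow>
     bij_betw h forests (basis A) \<and>
     unit A = bvec (h []) \<and>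
     (\<forall>u\<in>forests. \<forall>v\<in>forests. mult A (h u) (h v) = bvec (h (u @ v))) \<and>
     (\<forall>u\<in>forests. comult A (h u) = (\<Sum>(x, v)\<in>factorizations u. bvec (h x, h v))) \<and>
     (\<forall>u\<in>forests. counit A (h u) = (if u = unit_forest (length u) then 1 else 0))"

lemma factorizations_in_forests:
  "(x, v) \<in> factorizations u \<Longrightarrow> x \<in> forests \<and> v \<in> forests"
  by (simp add: factorizations_def)

lemma sum_scale_indicator:
  assumes "finite I" "i \<in> I" "\<And>j. j \<in> I \<Longrightarrow> c j = (if j = i then 1 else 0)"
  shows "(\<Sum>j\<in>I. scale (c j) (f j)) = f i"
proof -
  have "(\<Sum>j\<in>I. scale (c j) (f j)) = (\<Sum>j\<in>I. if i = j then f j else 0)"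
    using assms(3) by (intro sum.cong) auto
  then show ?thesis using assms(1,2) by (simp add: sum.delta')
qed

lemma append_eq_unit_forest:
  "u @ v = unit_forest (length (u @ v)) \<longleftrightarrow>
    u = unit_forest (length u) \<and> v = unit_forest (length v)"
  by (auto simp: unit_forest_def replicate_add append_eq_append_conv)

lemma bialgebra_presented:
  assumes "presented_by_forests A h"
  shows "bialgebra A"
proof -
  note P = assms[unfolded presented_by_forests_def]
  have B: "basis A = h ` forests"
    using P by (auto simp: bij_betw_def)
  have un: "unit A = bvec (h [])" using P by blast
  have mu: "mult A (h u) (h v) = bvec (h (u @ v))" if "u \<in> forests" "v \<in> forests" for u v
    using P that by blast
  have de: "comult A (h u) = (\<Sum>p\<in>factorizations u. bvec (h (fst p), h (snd p)))"
    if "u \<in> forests" for u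
    using P that by (simp add: case_prod_unfold)
  have co: "counit A (h u) = (if u = unit_forest (length u) then 1 else 0)"
    if "u \<in> forests" for u
    using P that by blast
  have fac: "fst p \<in> forests" "snd p \<in> forests" if "p \<in> factorizations u" for p u
    using that by (auto simp: factorizations_def)
  have coassoc: "lin_ext (\<lambda>((x, y), z). bvec (x, y, z))
          (lin_ext (\<lambda>(x, y). tensor (comult A x) (bvec y)) (comult A (h u))) =
        lin_ext (\<lambda>(x, y). tensor (bvec x) (comult A y)) (comult A (h u))"
    if u: "u \<in> forests" for u
  proof -
    have "lin_ext (\<lambda>((x, y), z). bvec (x, y, z))
          (lin_ext (\<lambda>(x, y). tensor (comult A x) (bvec y)) (comult A (h u))) =
        (\<Sum>p\<in>factorizations u. \<Sum>q\<in>factorizations (fst p).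
          bvec (h (fst q), h (snd q), h (snd p)))"
      by (simp add: de u fac lin_ext_sum tensor_def bilin_ext_sum_left)
    also have "\<dots> = (\<Sum>(p, q)\<in>(SIGMA p:factorizations u. factorizations (fst p)).
          bvec (h (fst q), h (snd q), h (snd p)))"
      by (rule sum.Sigma) (simp_all add: finite_factorizations)
    also have "\<dots> = (\<Sum>(p, q)\<in>(SIGMA p:factorizations u. factorizations (snd p)).
          bvec (h (fst p), h (fst q), h (snd q)))"
      \<comment> \<open>Coassociativity is this change of summation index, that is, associativity of
        grafting.\<close>
      using sum.reindex_bij_betw[OF bij_betw_factorizations_assoc[of u],
          of "\<lambda>(p, q). bvec (h (fst p), h (fst q), h (snd q))"]
      by (simp add: case_prod_unfold)
    also have "\<dots> = (\<Sum>p\<in>factorizations u. \<Sum>q\<in>factorizations (snd p).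
          bvec (h (fst p), h (fst q), h (snd q)))"
      by (rule sum.Sigma[symmetric]) (simp_all add: finite_factorizations)
    also have "\<dots> = lin_ext (\<lambda>(x, y). tensor (bvec x) (comult A y)) (comult A (h u))"
      by (simp add: de u fac lin_ext_sum tensor_def bilin_ext_sum_right)
    finally show ?thesis .
  qed
  have counit_left: "lin_ext (\<lambda>(x, y). scale (counit A x) (bvec y)) (comult A (h u)) = bvec (h u)"
    if u: "u \<in> forests" for u
  proof -
    let ?i = "(unit_forest (length (concat u)), u)"
    have "lin_ext (\<lambda>(x, y). scale (counit A x) (bvec y)) (comult A (h u)) =
        (\<Sum>p\<in>factorizations u. scale (counit A (h (fst p))) (bvec (h (snd p))))"
      by (simp add: de u lin_ext_sum)
    also have "\<dots> = bvec (h (snd ?i))"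
    proof (rule sum_scale_indicator)
      show "counit A (h (fst p)) = (if p = ?i then 1 else 0)" if "p \<in> factorizations u" for p
        using factorizations_unit_left[OF u, of "fst p" "snd p"] that fac(1)[OF that]
        by (simp add: co prod_eq_iff)
    qed (simp_all add: finite_factorizations unit_left_in_factorizations u)
    finally show ?thesis by simp
  qed
  have counit_right: "lin_ext (\<lambda>(x, y). scale (counit A y) (bvec x)) (comult A (h u)) = bvec (h u)"
    if u: "u \<in> forests" for u
  proof -
    let ?i = "(u, unit_forest (length u))"
    have "lin_ext (\<lambda>(x, y). scale (counit A y) (bvec x)) (comult A (h u)) =
        (\<Sum>p\<in>factorizations u. scale (counit A (h (snd p))) (bvec (h (fst p))))"
      by (simp add: de u lin_ext_sum)
    also have "\<dots> = bvec (h (fst ?i))"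
    proof (rule sum_scale_indicator)
      show "counit A (h (snd p)) = (if p = ?i then 1 else 0)" if "p \<in> factorizations u" for p
        using factorizations_unit_right[OF u, of "fst p" "snd p"] that fac(2)[OF that]
        by (auto simp: co prod_eq_iff)
    qed (simp_all add: finite_factorizations unit_right_in_factorizations u)
    finally show ?thesis by simp
  qed
  have comult_mult: "lin_ext (comult A) (mult A (h u) (h v)) =
      tensor_mult A (comult A (h u)) (comult A (h v))" if uv: "u \<in> forests" "v \<in> forests" for u v
  proof -
    have "lin_ext (comult A) (mult A (h u) (h v)) =
        (\<Sum>r\<in>factorizations (u @ v). bvec (h (fst r), h (snd r)))"
      by (simp add: mu de uv)
    also have "\<dots> = (\<Sum>(p, q)\<in>factorizations u \<times> factorizations v.
        bvec (h (fst p @ fst q), h (snd p @ snd q)))"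
      \<comment> \<open>The factorizations of \<open>u @ v\<close> are indexed by pairs of
        factorizations of \<open>u\<close> and \<open>v\<close>.\<close>
      by (subst sum.reindex_bij_betw[OF bij_betw_factorizations_append, symmetric])
        (simp add: case_prod_unfold)
    also have "\<dots> = (\<Sum>p\<in>factorizations u. \<Sum>q\<in>factorizations v.
        bvec (h (fst p @ fst q), h (snd p @ snd q)))"
      by (rule sum.cartesian_product[symmetric])
    also have "\<dots> = tensor_mult A (comult A (h u)) (comult A (h v))"
      by (simp add: de uv fac mu tensor_mult_def bilin_ext_sum)
    finally show ?thesis .
  qed
  have counit_mult: "lin_form (counit A) (mult A (h u) (h v)) = counit A (h u) * counit A (h v)"
    if uv: "u \<in> forests" "v \<in> forests" for u v
    using append_eq_unit_forest[of u v] by (simp add: mu co uv)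
  show ?thesis
    unfolding bialgebra_def B
  proof (intro conjI ballI)
    show "comult A a \<in> lin_span (h ` forests \<times> h ` forests)" if "a \<in> h ` forests" for a
      using that fac by (auto simp: de intro!: lin_span_sum)
    show "lin_ext (comult A) (unit A) = tensor (unit A) (unit A)"
      by (simp add: un de factorizations_Nil)
    show "lin_form (counit A) (unit A) = 1"
      by (simp add: un co unit_forest_def)
    show "lin_ext (comult A) (mult A a b) = tensor_mult A (comult A a) (comult A b)"
      "lin_form (counit A) (mult A a b) = counit A a * counit A b"
      if "a \<in> h ` forests" "b \<in> h ` forests" for a b
      using that comult_mult counit_mult by blast+
  qed (auto simp: un mu coassoc counit_left counit_right)
qed

lemma bialgebra_isomorphic_presented:
  assumes A: "presented_by_forests A h" and B: "presented_by_forests B k"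
  shows "bialgebra_isomorphic A B"
proof -
  define l where "l = k \<circ> inv_into forests h"
  have bij: "bij_betw h forests (basis A)" "bij_betw k forests (basis B)"
    using A B by (simp_all add: presented_by_forests_def)
  then have l: "bij_betw l (basis A) (basis B)"
    unfolding l_def by (intro bij_betw_trans[of _ _ forests] bij_betw_inv_into)
  have lh: "l (h u) = k u" if "u \<in> forests" for u
    unfolding l_def using bij_betw_inv_into_left[OF bij(1) that] by simp
  have basis: "basis A = h ` forests"
    using bij by (simp add: bij_betw_def)
  have fac: "fst p \<in> forests" "snd p \<in> forests" if "p \<in> factorizations u" for p u
    using that by (auto simp: factorizations_def)
  have "bialgebra_iso A B (\<lambda>a. bvec (l a))"
    unfolding bialgebra_iso_def
    using A B bij_betw_lin_ext[OF l]
    by (simp add: basis presented_by_forests_def lh lin_ext_sum case_prod_unfold fac)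
  then show ?thesis
    unfolding bialgebra_isomorphic_def
    using bialgebra_presented[OF A] bialgebra_presented[OF B] by blast
qed

section \<open>Expansion of plethystic substitution of the universal series\<close>

section \<open>The plethystic bialgebra\<close>

lemma sum_single_mult:
  "(\<Sum>i\<in>I. Poly_Mapping.single (a i) 1) * (\<Sum>j\<in>J. Poly_Mapping.single (b j) 1) =
    (\<Sum>i\<in>I. \<Sum>j\<in>J. Poly_Mapping.single (a i + b j) (1::rat))"
  by (simp add: sum_product mult_single)

lemma FMon_add [simp]: "FMon u + FMon v = FMon (u @ v)"
  by (simp add: plus_fmon_def)

text \<open>For the universal F every choice of monomials contributes one element of the free
  monoid, the list \<open>x\<close> in order, so the coefficient is the sum over all
  choices.\<close>

lemma series_product_univ_F:
  assumes "0 \<notin> set v"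
  shows "foldr ser_mult (map (\<lambda>k. ser_dil k univ_F) v) ser_one w =
    (\<Sum>x\<in>word_factorizations v w. Poly_Mapping.single (FMon x, 0) 1)"
  using assms
proof (induction v arbitrary: w)
  case Nil
  have "word_factorizations [] w = (if w = [] then {[]} else {})"
    by (auto simp: word_factorizations_def)
  then show ?case
    by (simp add: ser_one_def zero_fmon_def[symmetric] zero_prod_def[symmetric])
next
  case (Cons k v)
  let ?W = "\<lambda>a. {u \<in> words. map ((*) k) u = a}"
  have k: "k > 0" and v: "0 \<notin> set v" using Cons.prems by auto
  have fin: "finite {u. map ((*) k) u = a}" for a
    using map_mult_eq_subset[OF k] by (rule finite_subset) simp
  have dil: "ser_dil k univ_F a = (\<Sum>u\<in>?W a. Poly_Mapping.single (FMon [u], 0) 1)" for a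
    unfolding ser_dil_def
    by (rule sum.mono_neutral_cong_right) (auto simp: fin univ_F_def)
  have "foldr ser_mult (map (\<lambda>k. ser_dil k univ_F) (k # v)) ser_one w =
      (\<Sum>p\<in>{(a, b). a @ b = w}. \<Sum>q\<in>?W (fst p) \<times> word_factorizations v (snd p).
        Poly_Mapping.single (FMon (fst q # snd q), 0) 1)"
    by (simp add: ser_mult_def[of "ser_dil k univ_F"] dil Cons.IH[OF v] sum_single_mult
        sum.cartesian_product case_prod_unfold)
  also have "\<dots> = (\<Sum>(p, q)\<in>(SIGMA p:{(a, b). a @ b = w}.
        ?W (fst p) \<times> word_factorizations v (snd p)).
        Poly_Mapping.single (FMon (fst q # snd q), 0) 1)"
    by (rule sum.Sigma) (simp_all add: finite_append_eq fin finite_word_factorizations v)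
  also have "\<dots> = (\<Sum>x\<in>word_factorizations (k # v) w. Poly_Mapping.single (FMon x, 0) 1)"
    unfolding word_factorizations_Cons
    \<comment> \<open>The reindexing is injective: \<open>u\<close> and \<open>x\<close> determine
      the split \<open>(a, b)\<close> of \<open>w\<close>.\<close>
    by (subst sum.reindex)
      (use k in \<open>auto simp: inj_on_def word_factorizations_def case_prod_unfold\<close>)
  finally show ?case .
qed

lemma comult_gen_eq:
  "comult_gen w = (\<Sum>(x, v)\<in>factorizations [w]. bvec (FMon x, FMon v))"
proof -
  \<comment> \<open>A finite set containing every \<open>v\<close> with a nonzero summand, by
    \<open>word_factorizations_bound\<close>; it turns the sum in \<open>pleth\<close> into an
    ordinary one.\<close>
  let ?V = "{v \<in> words. set v \<subseteq> {..sum_list w} \<and> length v \<le> length w}"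
  have "finite {v. set v \<subseteq> {..sum_list w} \<and> length v \<le> length w}"
    by (rule finite_lists_length_le) simp
  then have fin: "finite ?V" by (rule rev_finite_subset) auto
  have G: "univ_G v * foldr ser_mult (map (\<lambda>k. ser_dil k univ_F) v) ser_one w =
      (\<Sum>x\<in>word_factorizations v w. bvec (FMon x, FMon [v]))" if "v \<in> words" for v
  proof -
    have "0 \<notin> set v" using that by (auto simp: words_def)
    then show ?thesis
      by (simp add: that univ_G_def series_product_univ_F sum_distrib_left mult_single bvec_def)
  qed
  have "comult_gen w =
      (\<Sum>v\<in>?V. univ_G v * foldr ser_mult (map (\<lambda>k. ser_dil k univ_F) v) ser_one w)"
    unfolding comult_gen_def pleth_def
  proof (rule Sum_any.expand_superset[OF fin], clarify)
    fix v assume *: "univ_G v * foldr ser_mult (map (\<lambda>k. ser_dil k univ_F) v) ser_one w \<noteq> 0"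
    then have "v \<in> words" by (auto simp: univ_G_def split: if_splits)
    with * have "word_factorizations v w \<noteq> {}" by (auto simp: G)
    with \<open>v \<in> words\<close> show "v \<in> words \<and> set v \<subseteq> {..sum_list w} \<and> length v \<le> length w"
      using word_factorizations_bound by blast
  qed
  also have "\<dots> = (\<Sum>v\<in>?V. \<Sum>x\<in>word_factorizations v w. bvec (FMon x, FMon [v]))"
    by (rule sum.cong) (simp_all add: G)
  also have "\<dots> = (\<Sum>(v, x)\<in>(SIGMA v:?V. word_factorizations v w). bvec (FMon x, FMon [v]))"
    using fin by (rule sum.Sigma) (auto intro!: finite_word_factorizations simp: words_def)
  \<comment> \<open>The bound can now be dropped: roots outside \<open>?V\<close> have no
    factorizations.\<close>
  also have "(SIGMA v:?V. word_factorizations v w) = (SIGMA v:words. word_factorizations v w)"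
    using word_factorizations_bound by fast
  also have "(\<Sum>(v, x)\<in>\<dots>. bvec (FMon x, FMon [v])) =
      (\<Sum>(x, v)\<in>factorizations [w]. bvec (FMon x, FMon v))"
    unfolding factorizations_single
    by (subst sum.reindex) (auto simp: inj_on_def case_prod_unfold)
  finally show ?thesis .
qed

lemma comult_forest_eq:
  "prod_list (map comult_gen u) = (\<Sum>(x, v)\<in>factorizations u. bvec (FMon x, FMon v))"
proof (induction u)
  case Nil
  then show ?case
    by (simp add: factorizations_Nil bvec_def zero_fmon_def[symmetric] zero_prod_def[symmetric])
next
  case (Cons w u)
  have "prod_list (map comult_gen (w # u)) = (\<Sum>(p, q)\<in>factorizations [w] \<times> factorizations u.
      bvec (FMon (fst p @ fst q), FMon (snd p @ snd q)))"
    by (simp add: Cons.IH comult_gen_eq case_prod_unfold bvec_def sum_single_mult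
        sum.cartesian_product)
  also have "\<dots> = (\<Sum>r\<in>factorizations ([w] @ u). bvec (FMon (fst r), FMon (snd r)))"
    by (subst sum.reindex_bij_betw[OF bij_betw_factorizations_append, symmetric])
      (simp add: case_prod_unfold)
  finally show ?case by (simp add: case_prod_unfold)
qed

lemma presented_plethystic_bialgebra: "presented_by_forests plethystic_bialgebra FMon"
proof -
  have "bij_betw FMon forests (basis plethystic_bialgebra)"
    by (rule bij_betw_byWitness[where f' = letters])
      (auto simp: plethystic_bialgebra_def forests_def)
  moreover have "prod_list (map (ser_var 1) u) =
      (if u = unit_forest (length u) then 1 else (0::rat))" for u
    by (induction u) (auto simp: unit_forest_def ser_var_def)
  ultimately show ?thesis
    by (simp add: presented_by_forests_def plethystic_bialgebra_def comult_forest_eq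
        zero_fmon_def plus_fmon_def)
qed

section \<open>Homotopy fibres and cardinalities reduced to strict fibres and counting\<close>

section \<open>Groupoids with only identity arrows\<close>

text \<open>Unlike \<open>disc\<close>, this applies when arrows and objects have different types,
  as in homotopy fibres, whose arrows are stored with their endpoints.\<close>

definition only_identities :: "('o, 'a) gpd \<Rightarrow> bool" where
  "only_identities G \<longleftrightarrow>
     (\<forall>x\<in>Obj G. Idt G x \<in> Arr G \<and> Dom G (Idt G x) = x \<and> Cod G (Idt G x) = x \<and>
        Cmp G (Idt G x) (Idt G x) = Idt G x) \<and>
     (\<forall>f\<in>Arr G. Dom G f \<in> Obj G \<and> Cod G f = Dom G f \<and> f = Idt G (Dom G f))"

lemma disc_only_identities: "disc G \<Longrightarrow> only_identities G"
  by (auto simp: disc_def only_identities_def)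

lemma disc_rename: "disc G \<Longrightarrow> (\<And>x. p' (p x) = x) \<Longrightarrow> disc (rename p p' p p' G)"
  by (auto simp: disc_def rename_def)

lemma iso_rel_only_identities: "only_identities G \<Longrightarrow> iso_rel G = Id_on (Obj G)"
  by (auto simp: only_identities_def iso_rel_def)

lemma pi0_only_identities: "only_identities G \<Longrightarrow> pi0 G = (\<lambda>x. {x}) ` Obj G"
  by (auto simp: pi0_def iso_rel_only_identities quotient_def)

lemma iso_class_only_identities: "only_identities G \<Longrightarrow> x \<in> Obj G \<Longrightarrow> iso_class G x = {x}"
  by (auto simp: iso_class_def iso_rel_only_identities)

lemma Aut_only_identities: "only_identities G \<Longrightarrow> x \<in> Obj G \<Longrightarrow> Aut G x = {Idt G x}"
  by (auto simp: Aut_def only_identities_def)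

lemma rep_singleton [simp]: "rep {x} = x"
  by (simp add: rep_def)

lemma hcard_only_identities: "only_identities G \<Longrightarrow> hcard G = of_nat (card (Obj G))"
  by (simp add: hcard_def pi0_only_identities sum.reindex Aut_only_identities)

lemma finite_gpd_only_identities: "only_identities G \<Longrightarrow> finite_gpd G \<longleftrightarrow> finite (Obj G)"
  by (simp add: finite_gpd_def pi0_only_identities Aut_only_identities finite_image_iff)

text \<open>An object carries an arrow from its image to \<open>b\<close>, which must be the
  identity, so the image is \<open>b\<close>. This also puts the image in \<open>Obj B\<close>,
  which is where \<open>F\<close> is asked to preserve identities.\<close>

lemma only_identities_hfib:
  assumes A: "only_identities A" and B: "only_identities B"
    and F: "\<And>x. x \<in> Obj A \<Longrightarrow> fob F x \<in> Obj B \<Longrightarrow> far F (Idt A x) = Idt B (fob F x)"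
  shows "only_identities (hfib F A B b)"
proof -
  have "\<beta> = Idt B b \<and> Dom B \<beta> = b" if "\<beta> \<in> Arr B" "Cod B \<beta> = b" for \<beta>
    using B that by (metis only_identities_def)
  note arr = this
  have "fob F a = b \<and> \<beta> = Idt B b \<and> far F (Idt A a) = \<beta> \<and> Cmp B \<beta> \<beta> = \<beta>"
    if "a \<in> Obj A" "\<beta> \<in> Arr B" "Dom B \<beta> = fob F a" "Cod B \<beta> = b" for a \<beta>
    using arr[OF that(2,4)] F[OF that(1)] B that unfolding only_identities_def by metis
  then show ?thesis
    using A unfolding only_identities_def hfib_def Let_def by (auto 0 3) metis+
qed

lemma Obj_hfib_only_identities:
  assumes B: "only_identities B" and b: "b \<in> Obj B"
  shows "Obj (hfib F A B b) = (\<lambda>x. (x, Idt B b)) ` {x \<in> Obj A. fob F x = b}"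
proof -
  have "\<beta> = Idt B b \<and> Dom B \<beta> = b" if "\<beta> \<in> Arr B" "Cod B \<beta> = b" for \<beta>
    using B that by (metis only_identities_def)
  then show ?thesis
    using B b by (auto simp: hfib_def Let_def only_identities_def)
qed

lemma card_Obj_hfib_only_identities:
  assumes "only_identities B" "b \<in> Obj B"
  shows "card (Obj (hfib F A B b)) = card {x \<in> Obj A. fob F x = b}"
  unfolding Obj_hfib_only_identities[OF assms] by (rule card_image) (simp add: inj_on_def)

section \<open>Discreteness of the bar construction of \<open>T_Mr Ass\<close>\<close>

section \<open>The bar construction of the T-construction of Ass\<close>

abbreviation (input) TAss :: "(unit, unit, unit list list, unit list list) operad" where
  "TAss \<equiv> T_Mr Ass"

lemma disc_col_TAss: "disc (col TAss)" and disc_opr_TAss: "disc (opr TAss)"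
  by (auto simp: disc_def T_Mr_Ass_simps discrete_def zip_same_conv_map intro!: map_idI)

lemma disc_Qn_TAss: "disc (Qn TAss n)"
proof (induction TAss n rule: Qn.induct)
  case 1
  then show ?case by (simp add: disc_rename disc_col_TAss)
next
  case 2
  then show ?case by (simp add: disc_rename disc_opr_TAss)
next
  case (3 n)
  then have "disc (pullback (Mr_map (outp_fun TAss)) (src TAss) (Mr (Qn TAss (Suc n))) (opr TAss))"
    by (intro disc_pullback disc_Mr disc_opr_TAss)
      (simp_all add: Mr_map_def outp_fun_def T_Mr_Ass_simps)
  then show ?case
    unfolding Qn.simps by (rule disc_rename) auto
qed

lemma disc_nsimp_TAss: "disc (nsimp (bar TAss) n)"
  by (simp add: bar_def disc_Mr disc_Qn_TAss)

lemma Idt_nsimp_TAss: "x \<in> Obj (nsimp (bar TAss) n) \<Longrightarrow> Idt (nsimp (bar TAss) n) x = x"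
  using disc_nsimp_TAss[of n] by (simp add: disc_def)

lemmas only_identities_nsimp_TAss = disc_only_identities[OF disc_nsimp_TAss]

lemma far_face_TAss: "far (face (bar TAss) n i) = fob (face (bar TAss) n i)"
  and far_degen_TAss: "far (degen (bar TAss) n i) = fob (degen (bar TAss) n i)"
  by (simp_all add: bar_def T_Mr_Ass_simps)

declare Qn.simps [simp del]

section \<open>Simplices of dimension 1 and 2 as forests, and their faces\<close>

definition encode :: "nat list \<Rightarrow> unit list list" where
  "encode w = map (\<lambda>n. replicate n ()) w"

lemma map_length_encode [simp]: "map length (encode w) = w"
  by (simp add: encode_def comp_def)

lemma length_encode [simp]: "length (encode w) = length w"
  by (simp add: encode_def)

lemma encode_simps [simp]:
  "encode [] = []" "encode (k # w) = replicate k () # encode w"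
  "encode (v @ w) = encode v @ encode w"
  by (simp_all add: encode_def)

lemma encode_inject [simp]: "encode v = encode w \<longleftrightarrow> v = w"
  by (metis map_length_encode)

lemma encode_words: "encode ` words = unary_words"
proof (intro equalityI subsetI)
  fix y assume "y \<in> unary_words"
  then have "map length y \<in> words"
    by (auto simp: unary_words_def words_def)
  moreover have "encode (map length y) = y"
    unfolding encode_def list.map_comp by (rule map_idI) (simp add: lists_unit_eq)
  ultimately show "y \<in> encode ` words" by (metis imageI)
qed (fastforce simp: unary_words_def words_def encode_def)

text \<open>Grafting \<open>k\<close> copies of an operation of arity n in \<open>Ass\<close> gives
  arity k times n, so the category obtained from \<open>Ass\<close> is the multiplicative
  monoid.\<close>

lemma mulw_encode: "mulw (encode g) (replicate k ()) = encode (map ((*) k) g)"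
  by (simp add: mulw_def encode_def lists_unit_eq length_concat_replicate)

lemma comw_encode: "length x = length v \<Longrightarrow> comw (map encode x) (encode v) = encode (compose x v)"
  by (induction x v rule: list_induct2) (simp_all add: mulw_encode)

type_synonym ulev = "(unit, unit list list) lev"

definition simplex1 :: "nat list list \<Rightarrow> ulev list" where
  "simplex1 u = map (\<lambda>w. Opr (encode w)) u"

fun simplex2 :: "nat list list \<Rightarrow> nat list list \<Rightarrow> ulev list" where
  "simplex2 x [] = []"
| "simplex2 x (v # vs) =
     Node (simplex1 (take (length v) x)) (encode v) # simplex2 (drop (length v) x) vs"

lemma simplex1_simps [simp]:
  "simplex1 [] = []" "simplex1 (w # u) = Opr (encode w) # simplex1 u"
  "simplex1 (u @ v) = simplex1 u @ simplex1 v" "length (simplex1 u) = length u"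
  by (simp_all add: simplex1_def)

lemma simplex1_inject [simp]: "simplex1 u = simplex1 v \<longleftrightarrow> u = v"
proof
  assume "simplex1 u = simplex1 v"
  then have "map (map length \<circ> root_op) (simplex1 u) = map (map length \<circ> root_op) (simplex1 v)"
    by simp
  then show "u = v" by (simp add: simplex1_def comp_def)
qed simp

lemma Obj_Q1: "Obj (Qn TAss (Suc 0)) = Opr ` encode ` words"
  by (simp add: Qn.simps rename_def T_Mr_Ass_simps encode_words)

lemma lists_Q1: "set xs \<subseteq> Obj (Qn TAss (Suc 0)) \<longleftrightarrow> xs \<in> simplex1 ` forests"
proof
  show "set xs \<subseteq> Obj (Qn TAss (Suc 0)) \<Longrightarrow> xs \<in> simplex1 ` forests"
  proof (induction xs)
    case (Cons a xs)
    then obtain w u where "w \<in> words" "u \<in> forests" "a = Opr (encode w)" "xs = simplex1 u"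
      by (auto simp: Obj_Q1)
    then show ?case by (intro image_eqI[of _ _ "w # u"]) auto
  qed (auto intro!: image_eqI[of _ _ "[]"])
qed (auto simp: simplex1_def forests_def Obj_Q1 intro!: imageI)

lemma Obj_nsimp1: "Obj (nsimp (bar TAss) (Suc 0)) = simplex1 ` (forests - {[]})"
proof -
  have "Obj (nsimp (bar TAss) (Suc 0)) = {xs. xs \<noteq> [] \<and> xs \<in> simplex1 ` forests}"
    by (simp add: bar_def Mr_def lists_Q1)
  also have "\<dots> = simplex1 ` (forests - {[]})"
    by (auto simp: simplex1_def)
  finally show ?thesis .
qed

text \<open>With a single colour, the matching of outputs with inputs in the pullback is equality of
  lengths.\<close>

lemma Obj_Q2: "Obj (Qn TAss (Suc (Suc 0))) =
  {Node (simplex1 x) (encode v) |x v. x \<in> forests \<and> v \<in> words \<and> length x = length v}"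
proof -
  have "Obj (Qn TAss (Suc (Suc 0))) = (\<lambda>(xs, y). Node xs y) `
      {(xs, y). xs \<noteq> [] \<and> xs \<in> simplex1 ` forests \<and> y \<in> encode ` words \<and> length xs = length y}"
    by (simp add: Qn.simps(3) rename_def pullback_def sub_gpd_def prod_gpd_def Mr_def lists_Q1 Mr_map_def
        T_Mr_Ass_simps encode_words map_unit_eq_replicate[of "outp _"] outp_fun_def
        lists_unit_eq) auto
  also have "\<dots> = {Node (simplex1 x) (encode v) |x v.
      x \<in> forests \<and> v \<in> words \<and> length x = length v}"
    by (force simp: simplex1_def words_def)
  finally show ?thesis .
qed

lemma simplex2_in_Obj:
  assumes "x \<in> forests" "v \<in> forests" "length x = length (concat v)"
  shows "set (simplex2 x v) \<subseteq> Obj (Qn TAss (Suc (Suc 0)))"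
  using assms
proof (induction v arbitrary: x)
  case (Cons w v)
  obtain x1 x2 where "x = x1 @ x2" "length x1 = length w" "length x2 = length (concat v)"
    using split_forest[OF Cons.prems(3)] .
  then show ?case using Cons by (auto simp: Obj_Q2)
qed simp

lemma simplex2_exhaust:
  assumes "set t \<subseteq> Obj (Qn TAss (Suc (Suc 0)))"
  shows "\<exists>x v. x \<in> forests \<and> v \<in> forests \<and> length x = length (concat v) \<and> t = simplex2 x v"
  using assms
proof (induction t)
  case (Cons a t)
  then obtain x v where "x \<in> forests" "v \<in> forests" "length x = length (concat v)"
    "t = simplex2 x v" by auto
  moreover obtain y w where "y \<in> forests" "w \<in> words" "length y = length w"
      "a = Node (simplex1 y) (encode w)"
    using Cons.prems by (auto simp: Obj_Q2)
  ultimately show ?case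
    by (intro exI[of _ "y @ x"] exI[of _ "w # v"]) simp
qed (auto intro!: exI[of _ "[]"])

lemma face0_simplex2: "fob (face (bar TAss) 2 0) (simplex2 x v) = simplex1 v"
  by (induction x v rule: simplex2.induct)
    (simp_all add: bar_def bar_face_def graft_def numeral_2_eq_2)

lemma face2_simplex2:
  assumes "length x = length (concat v)"
  shows "fob (face (bar TAss) 2 2) (simplex2 x v) = simplex1 x"
  using assms
proof (induction v arbitrary: x)
  case (Cons w v)
  obtain x1 x2 where "x = x1 @ x2" "length x1 = length w" "length x2 = length (concat v)"
    using split_forest[OF Cons.prems] .
  then show ?case using Cons.IH[of x2] by (simp add: bar_def bar_face_def)
qed (simp add: bar_def bar_face_def)

text \<open>The inner face composes each tree separately; hence the fibre of d_1 over a forest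
  consists of its factorizations.\<close>

lemma face1_simplex2:
  assumes "length x = length (concat v)"
  shows "fob (face (bar TAss) 2 (Suc 0)) (simplex2 x v) = simplex1 (graft_forest x v)"
  using assms
proof (induction v arbitrary: x)
  case (Cons w v)
  obtain x1 x2 where x: "x = x1 @ x2" "length x1 = length w" "length x2 = length (concat v)"
    using split_forest[OF Cons.prems] .
  have "map root_op (simplex1 x1) = map encode x1"
    by (simp add: simplex1_def)
  then show ?case using Cons.IH[of x2] x
    by (simp add: bar_def bar_face_def graft_def numeral_2_eq_2 com_T_Mr_Ass comw_encode)
qed (simp add: bar_def bar_face_def)

text \<open>Simplices are nonempty tuples, so the empty forest is left out; it corresponds to the
  adjoined unit.\<close>

lemma Obj_nsimp2: "Obj (nsimp (bar TAss) 2) = (\<lambda>(x, v). simplex2 x v) `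
  {(x, v). x \<in> forests \<and> v \<in> forests \<and> length x = length (concat v) \<and> v \<noteq> []}"
proof -
  have Nil: "simplex2 x v = [] \<longleftrightarrow> v = []" for x v
    by (cases v) simp_all
  have "Obj (nsimp (bar TAss) 2) = {t. t \<noteq> [] \<and> set t \<subseteq> Obj (Qn TAss (Suc (Suc 0)))}"
    by (simp add: bar_def Mr_def numeral_2_eq_2)
  also have "\<dots> = (\<lambda>(x, v). simplex2 x v) `
      {(x, v). x \<in> forests \<and> v \<in> forests \<and> length x = length (concat v) \<and> v \<noteq> []}"
    using simplex2_exhaust simplex2_in_Obj by (fastforce simp: Nil image_iff)
  finally show ?thesis .
qed

section \<open>The homotopy fibres in the comultiplication and the counit; local finiteness\<close>

lemma faces_in_simplex1:
  assumes "t \<in> Obj (nsimp (bar TAss) 2)" "fob (face (bar TAss) 2 (Suc 0)) t = simplex1 u"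
  obtains x v where "(x, v) \<in> factorizations u" "t = simplex2 x v"
proof -
  obtain x v where "x \<in> forests" "v \<in> forests" "length x = length (concat v)" "t = simplex2 x v"
    using assms(1) by (auto simp: Obj_nsimp2)
  then show thesis
    using assms(2) by (intro that[of x v]) (auto simp: face1_simplex2 factorizations_def)
qed

lemma only_identities_hfib_face:
  "only_identities (hfib (face (bar TAss) 2 (Suc 0)) (nsimp (bar TAss) 2)
    (nsimp (bar TAss) (Suc 0)) f)"
  by (intro only_identities_hfib only_identities_nsimp_TAss)
    (simp add: far_face_TAss Idt_nsimp_TAss)

lemma only_identities_hfib_degen:
  "only_identities (hfib (degen (bar TAss) 0 0) (nsimp (bar TAss) 0) (nsimp (bar TAss) (Suc 0)) f)"
  by (intro only_identities_hfib only_identities_nsimp_TAss)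
    (simp add: far_degen_TAss Idt_nsimp_TAss)

lemma only_identities_Phi: "only_identities (Phi (bar TAss) f a b)"
  unfolding Phi_def One_nat_def
proof (rule only_identities_hfib)
  let ?A = "hfib (face (bar TAss) 2 (Suc 0)) (nsimp (bar TAss) 2) (nsimp (bar TAss) (Suc 0)) f"
    and ?B = "prod_gpd (nsimp (bar TAss) (Suc 0)) (nsimp (bar TAss) (Suc 0))"
    and ?F = "fcomp (d2_d0 (bar TAss)) hfib_proj"
  show "only_identities ?A"
    by (rule only_identities_hfib_face)
  have disc: "disc ?B"
    by (intro disc_prod_gpd disc_nsimp_TAss)
  then show "only_identities ?B"
    by (rule disc_only_identities)
  fix x assume x: "x \<in> Obj ?A" "fob ?F x \<in> Obj ?B"
  then have "fst x \<in> Obj (nsimp (bar TAss) 2)"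
    by (auto simp: hfib_def Let_def)
  then show "far ?F (Idt ?A x) = Idt ?B (fob ?F x)"
    using x(2) disc disc_nsimp_TAss[of 2]
    by (simp add: disc_def fcomp_def d2_d0_def hfib_proj_def far_face_TAss)
      (simp add: hfib_def Let_def)
qed

text \<open>The cardinality counts 2-simplices with all three faces prescribed. The outer faces
  already force \<open>simplex2 x v\<close>, and the inner face decides whether it lies over
  \<open>u\<close>.\<close>

lemma hcard_Phi:
  assumes "u \<in> forests" "u \<noteq> []" "x \<in> forests" "x \<noteq> []" "v \<in> forests" "v \<noteq> []"
  shows "hcard (Phi (bar TAss) (simplex1 u) (simplex1 x) (simplex1 v)) =
    (if (x, v) \<in> factorizations u then 1 else 0)"
proof -
  let ?X = "bar TAss"
  let ?A = "hfib (face ?X 2 (Suc 0)) (nsimp ?X 2) (nsimp ?X (Suc 0)) (simplex1 u)"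
    and ?B = "prod_gpd (nsimp ?X (Suc 0)) (nsimp ?X (Suc 0))"
    and ?F = "fcomp (d2_d0 ?X) hfib_proj"
  have f: "simplex1 u \<in> Obj (nsimp ?X (Suc 0))" and ab: "(simplex1 x, simplex1 v) \<in> Obj ?B"
    using assms by (auto simp: Obj_nsimp1 prod_gpd_def)
  have B: "only_identities ?B"
    by (intro disc_only_identities disc_prod_gpd disc_nsimp_TAss)
  have "{p \<in> Obj ?A. fob ?F p = (simplex1 x, simplex1 v)} =
      (\<lambda>t. (t, Idt (nsimp ?X (Suc 0)) (simplex1 u))) `
      {t \<in> Obj (nsimp ?X 2). fob (face ?X 2 (Suc 0)) t = simplex1 u \<and>
        fob (face ?X 2 2) t = simplex1 x \<and> fob (face ?X 2 0) t = simplex1 v}"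
    unfolding Obj_hfib_only_identities[OF only_identities_nsimp_TAss f]
    by (auto simp: fcomp_def d2_d0_def hfib_proj_def)
  also have "{t \<in> Obj (nsimp ?X 2). fob (face ?X 2 (Suc 0)) t = simplex1 u \<and>
        fob (face ?X 2 2) t = simplex1 x \<and> fob (face ?X 2 0) t = simplex1 v} =
      (if (x, v) \<in> factorizations u then {simplex2 x v} else {})"
    using assms
    by (auto simp: Obj_nsimp2 face0_simplex2 face1_simplex2 face2_simplex2 factorizations_def)
  finally have "card {p \<in> Obj ?A. fob ?F p = (simplex1 x, simplex1 v)} =
      (if (x, v) \<in> factorizations u then 1 else 0)"
    by simp
  then show ?thesis
    unfolding hcard_only_identities[OF only_identities_Phi]
    unfolding Phi_def One_nat_def card_Obj_hfib_only_identities[OF B ab] by simp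
qed

text \<open>With one colour a 0-simplex is determined by its length, and s_0 sends it to the unit
  forest of that length.\<close>

lemma degen_fibre:
  assumes "u \<noteq> []"
  shows "{c \<in> Obj (nsimp (bar TAss) 0). fob (degen (bar TAss) 0 0) c = simplex1 u} =
    (if u = unit_forest (length u) then {replicate (length u) (Col ())} else {})"
proof -
  have Obj: "c \<in> Obj (nsimp (bar TAss) 0) \<longleftrightarrow> c \<noteq> [] \<and> c = replicate (length c) (Col ())" for c
  proof -
    have "set c \<subseteq> {Col ()} \<longleftrightarrow> c = replicate (length c) (Col ())"
      by (induction c) auto
    then show ?thesis
      by (simp add: bar_def Mr_def Qn.simps rename_def T_Mr_Ass_simps discrete_def)
  qed
  have degen: "fob (degen (bar TAss) 0 0) c = simplex1 (unit_forest (length c))" for c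
    by (induction c)
      (simp_all add: bar_def T_Mr_Ass_simps simplex1_def unit_forest_def encode_def)
  have len: "length (unit_forest n) = n" for n
    by (simp add: unit_forest_def)
  have "c \<in> Obj (nsimp (bar TAss) 0) \<and> fob (degen (bar TAss) 0 0) c = simplex1 u \<longleftrightarrow>
      u = unit_forest (length u) \<and> c = replicate (length u) (Col ())" for c
    unfolding Obj degen simplex1_inject using assms by (metis len length_0_conv length_replicate)
  then show ?thesis by auto
qed

lemma locally_finite_bar_TAss: "locally_finite (bar TAss)"
  unfolding locally_finite_def One_nat_def
proof (intro ballI conjI)
  let ?X = "bar TAss"
  fix f assume f: "f \<in> Obj (nsimp ?X (Suc 0))"
  then obtain u where u: "f = simplex1 u" "u \<in> forests" "u \<noteq> []"
    by (auto simp: Obj_nsimp1)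
  show "finite (Aut (nsimp ?X (Suc 0)) f)"
    using f by (simp add: Aut_only_identities[OF only_identities_nsimp_TAss])
  have "{t \<in> Obj (nsimp ?X 2). fob (face ?X 2 (Suc 0)) t = f} \<subseteq>
      (\<lambda>(x, v). simplex2 x v) ` factorizations u"
    unfolding u(1) by (auto elim!: faces_in_simplex1)
  then have "finite {t \<in> Obj (nsimp ?X 2). fob (face ?X 2 (Suc 0)) t = f}"
    by (rule finite_subset) (simp add: finite_factorizations)
  then show "finite_gpd (hfib (face ?X 2 (Suc 0)) (nsimp ?X 2) (nsimp ?X (Suc 0)) f)"
    by (simp add: finite_gpd_only_identities[OF only_identities_hfib_face]
        Obj_hfib_only_identities[OF only_identities_nsimp_TAss f])
  show "finite_gpd (hfib (degen ?X 0 0) (nsimp ?X 0) (nsimp ?X (Suc 0)) f)"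
    using degen_fibre[OF u(3)]
    by (simp add: finite_gpd_only_identities[OF only_identities_hfib_degen]
        Obj_hfib_only_identities[OF only_identities_nsimp_TAss f]) (simp add: u(1))
qed

section \<open>Structure constants of the incidence bialgebra\<close>

definition delta :: "nat list list \<Rightarrow> ulev list set option" where
  "delta u = (if u = [] then None else Some {simplex1 u})"

lemma delta_inject [simp]: "delta u = delta v \<longleftrightarrow> u = v"
  by (auto simp: delta_def)

lemma pi0_nsimp1: "pi0 (nsimp (bar TAss) (Suc 0)) = (\<lambda>u. {simplex1 u}) ` (forests - {[]})"
  unfolding pi0_only_identities[OF only_identities_nsimp_TAss] by (auto simp: Obj_nsimp1)

lemma inc_coeff_bar_TAss:
  assumes "u \<in> forests" "u \<noteq> []" "x \<in> forests" "x \<noteq> []" "v \<in> forests" "v \<noteq> []"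
  shows "inc_coeff (bar TAss) {simplex1 u} {simplex1 x} {simplex1 v} =
    (if (x, v) \<in> factorizations u then 1 else 0)"
  using assms
  by (simp add: inc_coeff_def hcard_Phi Aut_only_identities[OF only_identities_nsimp_TAss] Obj_nsimp1)

text \<open>Words are nonempty, so nonempty forests have nonempty factors; no term of their
  comultiplication involves the adjoined unit.\<close>

lemma factorizations_nonempty:
  assumes "u \<noteq> []" "(x, v) \<in> factorizations u"
  shows "x \<noteq> [] \<and> v \<noteq> []"
proof -
  have "length v = length u" "length x = length (concat v)" "v \<in> forests"
    using assms by (auto simp: factorizations_def)
  then show ?thesis using assms(1) by (cases v) (auto simp: words_def)
qed

lemma comult_incidence_bialgebra:
  assumes u: "u \<in> forests"
  shows "comult (incidence_bialgebra (bar TAss)) (delta u) =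
    (\<Sum>(x, v)\<in>factorizations u. bvec (delta x, delta v))"
proof (cases "u = []")
  case True
  then show ?thesis
    by (simp add: incidence_bialgebra_def delta_def factorizations_Nil)
next
  case False
  let ?X = "bar TAss" and ?f = "{simplex1 u}"
  let ?P = "\<lambda>(x, v). ({simplex1 x}, {simplex1 v})"
  \<comment> \<open>The support of the comultiplication is the set of factorizations, where every
    coefficient equals 1.\<close>
  have eq: "{(a, b). a \<in> pi0 (nsimp ?X (Suc 0)) \<and> b \<in> pi0 (nsimp ?X (Suc 0)) \<and> inc_coeff ?X ?f a b \<noteq> 0} =
      ?P ` factorizations u"
  proof (intro equalityI subsetI)
    fix p assume "p \<in> {(a, b). a \<in> pi0 (nsimp ?X (Suc 0)) \<and> b \<in> pi0 (nsimp ?X (Suc 0)) \<and>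
      inc_coeff ?X ?f a b \<noteq> 0}"
    then obtain x v where xv: "p = ?P (x, v)" "x \<in> forests" "x \<noteq> []" "v \<in> forests" "v \<noteq> []"
        "inc_coeff ?X ?f {simplex1 x} {simplex1 v} \<noteq> 0"
      unfolding pi0_nsimp1 by auto
    then have "(x, v) \<in> factorizations u"
      using inc_coeff_bar_TAss[OF u False xv(2-5)] by (auto split: if_splits)
    then show "p \<in> ?P ` factorizations u"
      unfolding xv(1) by (rule imageI)
  next
    fix p assume "p \<in> ?P ` factorizations u"
    then obtain x v where xv: "(x, v) \<in> factorizations u" "p = ?P (x, v)" by auto
    then show "p \<in> {(a, b). a \<in> pi0 (nsimp ?X (Suc 0)) \<and> b \<in> pi0 (nsimp ?X (Suc 0)) \<and>
      inc_coeff ?X ?f a b \<noteq> 0}"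
      using factorizations_nonempty[OF False xv(1)] factorizations_in_forests[OF xv(1)]
      by (simp add: inc_coeff_bar_TAss u False pi0_nsimp1)
  qed
  have "comult (incidence_bialgebra ?X) (delta u) =
      (\<Sum>(a, b)\<in>?P ` factorizations u. scale (inc_coeff ?X ?f a b) (bvec (Some a, Some b)))"
    using False by (simp add: incidence_bialgebra_def delta_def eq)
  also have "\<dots> = (\<Sum>(x, v)\<in>factorizations u.
      scale (inc_coeff ?X ?f {simplex1 x} {simplex1 v}) (bvec (Some {simplex1 x}, Some {simplex1 v})))"
    by (subst sum.reindex) (auto simp: inj_on_def case_prod_unfold)
  also have "\<dots> = (\<Sum>(x, v)\<in>factorizations u. bvec (delta x, delta v))"
  proof (rule sum.cong)
    fix p assume "p \<in> factorizations u"
    then obtain x v where xv: "(x, v) \<in> factorizations u" "p = (x, v)" by (cases p) auto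
    then show "(case p of (x, v) \<Rightarrow> scale (inc_coeff ?X ?f {simplex1 x} {simplex1 v})
        (bvec (Some {simplex1 x}, Some {simplex1 v}))) = (case p of (x, v) \<Rightarrow> bvec (delta x, delta v))"
      using factorizations_nonempty[OF False xv(1)] factorizations_in_forests[OF xv(1)]
      by (simp add: inc_coeff_bar_TAss u False delta_def)
  qed simp
  finally show ?thesis .
qed

lemma presented_incidence_bialgebra:
  "presented_by_forests (incidence_bialgebra (bar TAss)) delta"
  unfolding presented_by_forests_def
proof (intro conjI ballI)
  let ?X = "bar TAss"
  show "bij_betw delta forests (basis (incidence_bialgebra ?X))"
  proof (rule bij_betw_imageI)
    \<comment> \<open>The empty forest is split off, since it indexes the adjoined unit
      \<open>None\<close> instead of a class of 1-simplices.\<close>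
    have "delta ` forests = insert (delta []) (delta ` (forests - {[]}))"
      by (metis forests_simps(1) image_insert insert_Diff)
    then show "delta ` forests = basis (incidence_bialgebra ?X)"
      by (simp add: incidence_bialgebra_def pi0_nsimp1 delta_def image_image)
  qed (simp add: inj_on_def)
  show "unit (incidence_bialgebra ?X) = bvec (delta [])"
    by (simp add: incidence_bialgebra_def delta_def)
  fix u assume u: "u \<in> forests"
  show "mult (incidence_bialgebra ?X) (delta u) (delta v) = bvec (delta (u @ v))"
    if v: "v \<in> forests" for v
  proof -
    have "simplex1 u @ simplex1 v \<in> Obj (nsimp ?X (Suc 0))" if "u \<noteq> []"
      using u v that by (auto simp: Obj_nsimp1 simp flip: simplex1_simps)
    then show ?thesis
      using iso_class_only_identities[OF only_identities_nsimp_TAss]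
      by (simp add: incidence_bialgebra_def delta_def)
  qed
  show "comult (incidence_bialgebra ?X) (delta u) =
      (\<Sum>(x, v)\<in>factorizations u. bvec (delta x, delta v))"
    by (rule comult_incidence_bialgebra[OF u])
  show "counit (incidence_bialgebra ?X) (delta u) = (if u = unit_forest (length u) then 1 else 0)"
  proof (cases "u = []")
    case False
    then have f: "simplex1 u \<in> Obj (nsimp ?X (Suc 0))"
      using u by (simp add: Obj_nsimp1)
    have "counit (incidence_bialgebra ?X) (delta u) =
        of_nat (card {c \<in> Obj (nsimp ?X 0). fob (degen ?X 0 0) c = simplex1 u})"
      using False card_Obj_hfib_only_identities[OF only_identities_nsimp_TAss f]
      by (simp add: incidence_bialgebra_def delta_def
          hcard_only_identities[OF only_identities_hfib_degen])
    then show ?thesis by (simp add: degen_fibre[OF False])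
  qed (simp add: incidence_bialgebra_def delta_def unit_forest_def)
qed

theorem theorem5p15:
  shows "locally_finite (bar (T_Mr Ass)) \<and>
    bialgebra_isomorphic plethystic_bialgebra (incidence_bialgebra (bar (T_Mr Ass)))"
  using locally_finite_bar_TAss
    bialgebra_isomorphic_presented[OF presented_plethystic_bialgebra presented_incidence_bialgebra]
  by blast

end
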